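(* Assume $\hat{\mathbb P}_x=\mathcal N(\hat\mu_x,\hat\Sigma_x)$ and $\hat{\mathbb P}_w=\mathcal N(\hat\mu_w,\hat\Sigma_w)$. Then $\sup_{\mathbb Q\in\mathbb B_{\mathcal N}(\hat{\mathbb P})}\inf_{\psi\in\mathcal F}\mathcal R(\psi,\mathbb Q)$ equals the optimal value of $$\begin{array}{cl}\sup & \mathrm{Tr}\big[\Sigma_x-\Sigma_xH^\top(H\Sigma_xH^\top+\Sigma_w)^{-1}H\Sigma_x\big]\\ \text{s.t.} & \Sigma_x\in\mathbb S^n_+,\ \Sigma_w\in\mathbb S^m_{++},\\ & \mathrm{Tr}[\Sigma_x+\hat\Sigma_x-2(\hat\Sigma_x^{1/2}\Sigma_x\hat\Sigma_x^{1/2})^{1/2}]\le\rho_x^2,\\ & \mathrm{Tr}[\Sigma_w+\hat\Sigma_w-2(\hat\Sigma_w^{1/2}\Sigma_w\hat\Sigma_w^{1/2})^{1/2}]\le\rho_w^2.\end{array}\qquad(\ast\ast)$$ If moreover $\hat\Sigma_w\succ0$, then $(\ast\ast)$ is solvable, it has a maximizer $(\Sigma_x^\star,\Sigma_w^\star)$ with $\Sigma_x^\star\succeq\lambda_{\min}(\hat\Sigma_x)I_n$ and $\Sigma_w^\star\succeq\lambda_{\min}(\hat\Sigma_w)I_m$, and for any maximizer $(\Sigma_x^\star,\Sigma_w^\star)$ of $(\ast\ast)$ the supremum over $\mathbb B_{\mathcal N}(\hat{\mathbb P})$ is attained by $\mathbb Q^\star=\mathcal N(\hat\mu_x,\Sigma_x^\star)\times\mathcal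 N(\hat\mu_w,\Sigma_w^\star)$.
   Context: Standing setup. Fix $n,m\in\mathbb N$ and $H\in\mathbb R^{m\times n}$. For $d\in\mathbb N$, $\mathcal M(\mathbb R^d)$ is the set of Borel probability distributions on $\mathbb R^d$ with finite second moments; $\mathbb W$ is the type-2 Wasserstein distance $\mathbb W(\mathbb Q_1,\mathbb Q_2)=\inf_{\pi\in\Pi(\mathbb Q_1,\mathbb Q_2)}(\int\|\xi_1-\xi_2\|^2d\pi)^{1/2}$ over couplings. $\mathcal N(\mu,\Sigma)$ denotes the (possibly degenerate) normal distribution with mean $\mu$ and covariance $\Sigma\in\mathbb S^d_+$. The signal $x\in\mathbb R^n$ and noise $w\in\mathbb R^m$ have joint distribution $\mathbb Q$; $\mathcal F$ is the set of measurable $\psi:\mathbb R^m\to\mathbb R^n$ with $\|\psi(y)\|\le C(1+\|y\|)$ for some $C>0$; $\mathcal R(\psi,\mathbb Q)=\mathbb E_{\mathbb Q}[\|x-\psi(Hx+w)\|^2]$. The nominal distribution is $\hat{\mathbb P}=\hat{\mathbb P}_x\times\hat{\mathbb P}_w$ with means $\hat\mu_x,\hat\mu_w$ and covariances $\hat\Sigma_x\in\mathbb S^n_+,\hat\Sigma_w\in\mathbb S^m_+$; radii $\rho_x,\rho_w\ge0$. The restricted normal ambiguity set is $\mathbb B_{\mathcal N}(\hat{\mathbb P})=\{\mathcal N(\hat\mu_x,\Sigma_x)\times\mathcal N(\hat\mu_w,\Sigma_w):\Sigma_x\in\mathbb S^n_+,\ \Sigma_w\in\mathbb S^m_{++},\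 \mathbb W(\mathcal N(\hat\mu_x,\Sigma_x),\hat{\mathbb P}_x)\le\rho_x,\ \mathbb W(\mathcal N(\hat\mu_w,\Sigma_w),\hat{\mathbb P}_w)\le\rho_w\}$. $\mathbb S^d_{++}$ denotes positive definite matrices and $\lambda_{\min}$ the smallest eigenvalue. *)

theory Defs
  imports "HOL-Analysis.Analysis" "HOL-Probability.Probability"
begin

definition psd_mat :: "real^'d^'d \<Rightarrow> bool" where
  "psd_mat A \<longleftrightarrow> transpose A = A \<and> (\<forall>v. 0 \<le> v \<bullet> (A *v v))"

definition pd_mat :: "real^'d^'d \<Rightarrow> bool" where
  "pd_mat A \<longleftrightarrow> transpose A = A \<and> (\<forall>v. v \<noteq> 0 \<longrightarrow> 0 < v \<bullet> (A *v v))"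

definition loewner_ge :: "real^'d^'d \<Rightarrow> real^'d^'d \<Rightarrow> bool" where
  "loewner_ge A B \<longleftrightarrow> psd_mat (A - B)"

definition msqrt :: "real^'d^'d \<Rightarrow> real^'d^'d" where
  "msqrt A = (THE R. psd_mat R \<and> R ** R = A)"

text \<open>Smallest eigenvalue (of a symmetric matrix, whose eigenvalues are real).\<close>
definition lambda_min :: "real^'d^'d \<Rightarrow> real" where
  "lambda_min A = Min {l. \<exists>v. v \<noteq> 0 \<and> A *v v = l *\<^sub>R v}"

definition std_gauss :: "(real^'d) measure" where
  "std_gauss = density lborel (\<lambda>z. ennreal (\<Prod>i\<in>UNIV. std_normal_density (z $ i)))"

text \<open>The (possibly degenerate) normal distribution N(mu, Sigma): the law of mu + Sigma^(1/2) Z.\<close>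
definition gauss :: "real^'d \<Rightarrow> real^'d^'d \<Rightarrow> (real^'d) measure" where
  "gauss mu S = distr std_gauss borel (\<lambda>z. mu + msqrt S *v z)"

definition couplings :: "(real^'d) measure \<Rightarrow> (real^'d) measure \<Rightarrow> ((real^'d) \<times> (real^'d)) measure set" where
  "couplings Q1 Q2 = {\<pi>. prob_space \<pi> \<and> sets \<pi> = sets borel \<and>
      distr \<pi> borel fst = Q1 \<and> distr \<pi> borel snd = Q2}"

definition wasserstein2 :: "(real^'d) measure \<Rightarrow> (real^'d) measure \<Rightarrow> real" where
  "wasserstein2 Q1 Q2 =
     sqrt (enn2real (INF \<pi>\<in>couplings Q1 Q2. \<integral>\<^sup>+ p. ennreal ((norm (fst p - snd p))\<^sup>2) \<partial>\<pi>))"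

definition estimators :: "(real^'m \<Rightarrow> real^'n) set" where
  "estimators = {\<psi>. \<psi> \<in> borel_measurable borel \<and>
      (\<exists>C>0. \<forall>y. norm (\<psi> y) \<le> C * (1 + norm y))}"

text \<open>Mean squared error of estimator psi under joint law Q of (x, w), observation y = Hx + w.\<close>
definition mse :: "real^'n^'m \<Rightarrow> (real^'m \<Rightarrow> real^'n) \<Rightarrow> ((real^'n) \<times> (real^'m)) measure \<Rightarrow> real" where
  "mse H \<psi> Q = (\<integral>p. (norm (fst p - \<psi> (H *v fst p + snd p)))\<^sup>2 \<partial>Q)"

definition normal_ambiguity_set ::
  "real^'n \<Rightarrow> real^'n^'n \<Rightarrow> real^'m \<Rightarrow> real^'m^'m \<Rightarrow> real \<Rightarrow> real \<Rightarrow> ((real^'n) \<times> (real^'m)) measure set" where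
  "normal_ambiguity_set mux Sx0 muw Sw0 rx rw =
     {gauss mux Sx \<Otimes>\<^sub>M gauss muw Sw | Sx Sw.
        psd_mat Sx \<and> pd_mat Sw \<and>
        wasserstein2 (gauss mux Sx) (gauss mux Sx0) \<le> rx \<and>
        wasserstein2 (gauss muw Sw) (gauss muw Sw0) \<le> rw}"

definition mmse_obj :: "real^'n^'m \<Rightarrow> real^'n^'n \<Rightarrow> real^'m^'m \<Rightarrow> real" where
  "mmse_obj H Sx Sw = trace (Sx - Sx ** transpose H ** matrix_inv (H ** Sx ** transpose H + Sw) ** H ** Sx)"

definition gelbrich_sq :: "real^'d^'d \<Rightarrow> real^'d^'d \<Rightarrow> real" where
  "gelbrich_sq S S0 = trace (S + S0 - 2 *\<^sub>R msqrt (msqrt S0 ** S ** msqrt S0))"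

definition feasible ::
  "real^'n^'n \<Rightarrow> real^'m^'m \<Rightarrow> real \<Rightarrow> real \<Rightarrow> ((real^'n^'n) \<times> (real^'m^'m)) set" where
  "feasible Sx0 Sw0 rx rw = {(Sx, Sw). psd_mat Sx \<and> pd_mat Sw \<and>
      gelbrich_sq Sx Sx0 \<le> rx\<^sup>2 \<and> gelbrich_sq Sw Sw0 \<le> rw\<^sup>2}"

end

theory Submission
  imports Defs
begin

text \<open>
  The fidelity of \<open>S\<close> and \<open>S0\<close> is the trace of the square root of \<open>R S R\<close>, where \<open>R\<close> is the
  square root of \<open>S0\<close>. It bounds the trace of every cross moment matrix compatible with the second
  moments \<open>S\<close> and \<open>S0\<close>, and the bound is attained by the law of \<open>(mu + X Z, mu + R Z)\<close> with \<open>Z\<close>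
  standard normal and \<open>X X\<^sup>T = S\<close>, where \<open>X\<close> comes from a polar decomposition. Hence the
  Wasserstein distance of normal laws is the Gelbrich distance, and a Gelbrich ball is the image of
  a Frobenius ball around \<open>R\<close> under \<open>X \<mapsto> X X\<^sup>T\<close>; in particular it is compact.

  For normal laws the linear estimator with the usual gain is optimal: a reflection, under which the
  standard normal law is invariant, fixes the observation and flips the sign of the error. The
  minimal error is an infimum of functions that are linear and monotone in the covariances, so it
  is upper semicontinuous and monotone in the Loewner order. Raising the small eigenvalues of an
  element of a Gelbrich ball around \<open>S0\<close> to \<open>lambda_min S0\<close> does not leave the ball, so the supremum
  may be taken over a compact set on which the noise covariance is uniformly definite.
\<close>

section \<open>Matrices as a normed algebra\<close>

declare transpose_matrix_vector [simp del]

interpretation matrix_mult: bounded_bilinear "(**) :: real^'n^'m \<Rightarrow> real^'k^'n \<Rightarrow> real^'k^'m"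
  by (auto simp: bilinear_conv_bounded_bilinear [symmetric] bilinear_def linear_iff
      matrix_matrix_mult_def vec_eq_iff sum.distrib algebra_simps sum_distrib_left)

interpretation matrix_vector_mult: bounded_bilinear "(*v) :: real^'n^'m \<Rightarrow> real^'n \<Rightarrow> real^'m"
  by (auto simp: bilinear_conv_bounded_bilinear [symmetric] bilinear_def linear_iff
      matrix_vector_mult_def vec_eq_iff sum.distrib algebra_simps sum_distrib_left)

lemma bounded_linear_transpose: "bounded_linear (transpose :: real^'n^'m \<Rightarrow> real^'m^'n)"
  by (auto simp: linear_conv_bounded_linear [symmetric] linear_iff transpose_def vec_eq_iff)

lemma bounded_linear_trace: "bounded_linear (trace :: real^'n^'n \<Rightarrow> real)"
  by (auto simp: linear_conv_bounded_linear [symmetric] linear_iff trace_def sum.distrib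
      sum_distrib_left)

lemmas transpose_add = linear_add [OF bounded_linear.linear [OF bounded_linear_transpose]]
lemmas transpose_diff = linear_diff [OF bounded_linear.linear [OF bounded_linear_transpose]]
lemmas transpose_sum = linear_sum [OF bounded_linear.linear [OF bounded_linear_transpose]]
lemmas trace_scaleR = linear_scale [OF bounded_linear.linear [OF bounded_linear_trace]]
lemmas trace_sum = linear_sum [OF bounded_linear.linear [OF bounded_linear_trace]]

lemmas matrix_mult_distribs =
  matrix_mult.add_left matrix_mult.add_right matrix_mult.diff_left matrix_mult.diff_right
  matrix_mult.scaleR_left matrix_mult.scaleR_right

lemmas matrix_continuous_intros [continuous_intros] =
  matrix_mult.continuous_on matrix_vector_mult.continuous_on
  bounded_linear.continuous_on [OF bounded_linear_transpose]
  bounded_linear.continuous_on [OF bounded_linear_trace]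

lemma inner_matrix_vector_mult: "x \<bullet> (A *v y) = (transpose A *v x) \<bullet> y" for A :: "real^'n^'m"
  by (simp add: transpose_matrix_vector dot_lmul_matrix)

lemma inner_matrix_eq_trace: "X \<bullet> Y = trace (transpose X ** Y)" for X :: "real^'n^'m"
proof -
  have "trace (transpose X ** Y) = (\<Sum>i\<in>UNIV. \<Sum>k\<in>UNIV. X $ k $ i * Y $ k $ i)"
    by (simp add: trace_def matrix_matrix_mult_def transpose_def)
  also have "\<dots> = X \<bullet> Y"
    by (subst sum.swap) (simp add: inner_vec_def)
  finally show ?thesis ..
qed

lemma inner_symmetric_eq_trace: "transpose R = R \<Longrightarrow> X \<bullet> R = trace (X ** R)" for X R :: "real^'n^'n"
  by (metis inner_commute inner_matrix_eq_trace trace_mul_sym)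

lemma norm_matrix_eq_trace: "(norm X)\<^sup>2 = trace (X ** transpose X)" for X :: "real^'n^'m"
  unfolding power2_norm_eq_inner inner_matrix_eq_trace by (rule trace_mul_sym)

lemma invertible_matrix_inv:
  assumes "invertible (A :: real^'n^'n)"
  shows "A ** matrix_inv A = mat 1" "matrix_inv A ** A = mat 1"
  using someI_ex [OF assms [unfolded invertible_def]] by (simp_all add: matrix_inv_def)

section \<open>The spectral theorem\<close>

lemma quadratic_nonneg_imp_linear_coeff_0:
  fixes a b :: real
  assumes "\<And>t. 0 \<le> 2 * t * a + t\<^sup>2 * b"
  shows "a = 0"
proof (rule ccontr)
  assume "a \<noteq> 0"
  define c where "c = \<bar>b\<bar> + 1"
  have c: "c > 0" "b < c" by (auto simp: c_def)
  have "0 \<le> 2 * (- a / c) * a + (- a / c)\<^sup>2 * b" by (rule assms)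
  also have "\<dots> = a\<^sup>2 / c\<^sup>2 * (b - 2 * c)"
    using c by (simp add: field_simps power2_eq_square)
  also have "\<dots> < 0"
    using c \<open>a \<noteq> 0\<close> by (intro mult_pos_neg) auto
  finally show False by simp
qed

lemma rayleigh_quotient_attains_min:
  fixes f :: "'a::euclidean_space \<Rightarrow> 'a"
  assumes lin: "linear f" and V: "subspace V" "V \<noteq> {0}"
  obtains v where "v \<in> V" "norm v = 1" "\<And>u. u \<in> V \<Longrightarrow> (v \<bullet> f v) * (u \<bullet> u) \<le> u \<bullet> f u"
proof -
  let ?C = "V \<inter> sphere 0 1"
  have normalized: "(1 / norm u) *\<^sub>R u \<in> ?C" if "u \<in> V" "u \<noteq> 0" for u
    using that V by (auto simp: subspace_scale)
  obtain u where "u \<in> V" "u \<noteq> 0" using V subspace_0 by blast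
  then have "?C \<noteq> {}" using normalized by blast
  moreover have "compact ?C"
    using V by (simp add: closed_subspace closed_Int_compact)
  moreover have "continuous_on ?C (\<lambda>u. u \<bullet> f u)"
    using lin
    by (intro continuous_intros linear_continuous_on) (simp add: linear_conv_bounded_linear)
  ultimately obtain v where v: "v \<in> ?C" and minimal: "\<And>u. u \<in> ?C \<Longrightarrow> v \<bullet> f v \<le> u \<bullet> f u"
    using continuous_attains_inf [of ?C "\<lambda>u. u \<bullet> f u"] by blast
  have "(v \<bullet> f v) * (u \<bullet> u) \<le> u \<bullet> f u" if "u \<in> V" for u
  proof (cases "u = 0")
    case False
    have "v \<bullet> f v \<le> ((1 / norm u) *\<^sub>R u) \<bullet> f ((1 / norm u) *\<^sub>R u)"
      using normalized [OF that False] by (rule minimal)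
    also have "\<dots> = (u \<bullet> f u) / (u \<bullet> u)"
      by (simp add: linear_scale [OF lin] power2_eq_square flip: power2_norm_eq_inner)
    finally show ?thesis using False by (simp add: field_simps)
  qed (simp add: linear_0 [OF lin])
  with that v show thesis by auto
qed

lemma self_adjoint_eigenvector_in_subspace:
  fixes f :: "'a::euclidean_space \<Rightarrow> 'a"
  assumes lin: "linear f" and self_adjoint: "\<And>x y. x \<bullet> f y = f x \<bullet> y"
    and V: "subspace V" "V \<noteq> {0}" and invariant: "\<And>u. u \<in> V \<Longrightarrow> f u \<in> V"
  obtains v l where "v \<in> V" "norm v = 1" "f v = l *\<^sub>R v"
proof -
  obtain v where v: "v \<in> V" "norm v = 1" and minimal: "\<And>u. u \<in> V \<Longrightarrow> (v \<bullet> f v) * (u \<bullet> u) \<le> u \<bullet> f u"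
    by (rule rayleigh_quotient_attains_min [OF lin V]) blast
  define l where "l = v \<bullet> f v"
  have "w \<bullet> (f v - l *\<^sub>R v) = 0" if w: "w \<in> V" for w
  proof (rule quadratic_nonneg_imp_linear_coeff_0)
    fix t :: real
    have "v + t *\<^sub>R w \<in> V" using w v V by (simp add: subspace_add subspace_scale)
    from minimal [OF this]
    show "0 \<le> 2 * t * (w \<bullet> (f v - l *\<^sub>R v)) + t\<^sup>2 * (w \<bullet> f w - l * (w \<bullet> w))"
      using v(2) self_adjoint [of v w]
      by (simp add: linear_add [OF lin] linear_scale [OF lin] l_def [symmetric] norm_eq_1
          algebra_simps power2_eq_square inner_commute)
  qed
  then have "f v - l *\<^sub>R v = 0"
    using v invariant V by (metis inner_eq_zero_iff subspace_diff subspace_scale)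
  with that v show thesis by simp
qed

definition orthonormal_basis :: "'a::euclidean_space set \<Rightarrow> bool" where
  "orthonormal_basis B \<longleftrightarrow> pairwise orthogonal B \<and> (\<forall>b\<in>B. norm b = 1) \<and> span B = UNIV"

lemma self_adjoint_orthonormal_eigenbasis:
  fixes f :: "'a::euclidean_space \<Rightarrow> 'a"
  assumes lin: "linear f" and self_adjoint: "\<And>x y. x \<bullet> f y = f x \<bullet> y"
  obtains B l where "orthonormal_basis B" "\<And>b. b \<in> B \<Longrightarrow> f b = l b *\<^sub>R b"
proof -
  define eigensystem where "eigensystem B \<longleftrightarrow>
      pairwise orthogonal B \<and> (\<forall>b\<in>B. norm b = 1) \<and> (\<forall>b\<in>B. \<exists>l. f b = l *\<^sub>R b)" for B
  have bound: "finite B \<and> card B < Suc (DIM('a))" if "eigensystem B" for B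
  proof -
    have "independent B"
      using that by (intro pairwise_orthogonal_independent) (auto simp: eigensystem_def)
    then show ?thesis using independent_bound by (simp add: less_Suc_eq_le)
  qed
  have "eigensystem {}" by (simp add: eigensystem_def)
  with bound have "\<exists>B. eigensystem B \<and> (\<forall>C. eigensystem C \<longrightarrow> card C \<le> card B)"
    by (intro ex_has_greatest_nat [where f = card]) auto
  then obtain B where B: "eigensystem B" and maximal: "\<And>C. eigensystem C \<Longrightarrow> card C \<le> card B"
    by blast
  have "span B = UNIV"
  proof (rule ccontr)
    assume "span B \<noteq> UNIV"
    then obtain x where x: "x \<noteq> 0" "\<And>y. y \<in> span B \<Longrightarrow> orthogonal x y"
      using orthogonal_to_subspace_exists_gen [of B UNIV] by auto
    define V where "V = {y. \<forall>b\<in>B. orthogonal b y}"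
    have "f u \<in> V" if "u \<in> V" for u
      using that B by (auto simp: V_def eigensystem_def orthogonal_def self_adjoint)
    moreover have "subspace V" unfolding V_def by (rule subspace_orthogonal_to_vectors)
    moreover have "V \<noteq> {0}" using x by (auto simp: V_def span_base orthogonal_commute)
    ultimately obtain v l where v: "v \<in> V" "norm v = 1" "f v = l *\<^sub>R v"
      using self_adjoint_eigenvector_in_subspace [OF lin self_adjoint] by metis
    then have "v \<notin> B" by (auto simp: V_def orthogonal_def)
    moreover have "eigensystem (insert v B)"
      using B v by (auto simp: eigensystem_def V_def pairwise_insert orthogonal_commute)
    ultimately show False using maximal [of "insert v B"] bound [OF B] by simp
  qed
  moreover obtain l where "\<And>b. b \<in> B \<Longrightarrow> f b = l b *\<^sub>R b"
    using B unfolding eigensystem_def by metis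
  ultimately show thesis using that B unfolding eigensystem_def orthonormal_basis_def by blast
qed

definition outer :: "real^'n \<Rightarrow> real^'n^'n" where
  "outer v = (\<chi> i j. v $ i * v $ j)"

lemma outer_mult_vec: "outer v *v x = (v \<bullet> x) *\<^sub>R v"
  by (simp add: outer_def matrix_vector_mult_def vec_eq_iff inner_vec_def sum_distrib_left
      algebra_simps)

lemma transpose_outer: "transpose (outer v) = outer v"
  by (simp add: outer_def transpose_def vec_eq_iff mult.commute)

lemma trace_mult_outer: "trace (A ** outer v) = v \<bullet> (A *v v)"
proof -
  have "trace (A ** outer v) = (\<Sum>i\<in>UNIV. \<Sum>k\<in>UNIV. A $ i $ k * (v $ k * v $ i))"
    by (simp add: trace_def matrix_matrix_mult_def outer_def)
  then show ?thesis
    by (simp add: inner_vec_def matrix_vector_mult_def sum_distrib_left algebra_simps)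
qed

definition spectral_sum :: "(real^'n) set \<Rightarrow> (real^'n \<Rightarrow> real) \<Rightarrow> real^'n^'n" where
  "spectral_sum B f = (\<Sum>b\<in>B. f b *\<^sub>R outer b)"

lemma trace_mult_spectral_sum: "trace (A ** spectral_sum B f) = (\<Sum>b\<in>B. f b * (b \<bullet> (A *v b)))"
  by (simp add: spectral_sum_def matrix_mult.sum_right matrix_mult.scaleR_right trace_sum
      trace_scaleR trace_mult_outer)

lemma inner_spectral_sum: "v \<bullet> (spectral_sum B f *v v) = (\<Sum>b\<in>B. f b * (b \<bullet> v)\<^sup>2)"
  by (simp add: spectral_sum_def matrix_vector_mult.sum_left matrix_vector_mult.scaleR_left
      inner_sum_right outer_mult_vec power2_eq_square inner_commute mult.assoc)

lemma transpose_spectral_sum: "transpose (spectral_sum B f) = spectral_sum B f"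
  by (simp add: spectral_sum_def transpose_sum transpose_scalar transpose_outer)

lemma spectral_sum_diff: "spectral_sum B f - spectral_sum B g = spectral_sum B (\<lambda>b. f b - g b)"
  by (simp add: spectral_sum_def sum_subtractf scaleR_left_diff_distrib)

context
  fixes B :: "(real^'n) set"
  assumes B: "orthonormal_basis B"
begin

lemma finite_orthonormal_basis: "finite B"
  using B pairwise_orthogonal_imp_finite by (auto simp: orthonormal_basis_def)

lemma inner_orthonormal_basis: "b \<in> B \<Longrightarrow> c \<in> B \<Longrightarrow> b \<bullet> c = (if c = b then 1 else 0)"
  using B by (auto simp: orthonormal_basis_def pairwise_def orthogonal_def norm_eq_1)

lemma matrix_eq_on_orthonormal_basis:
  fixes A A' :: "real^'n^'m"
  assumes "\<And>b. b \<in> B \<Longrightarrow> A *v b = A' *v b"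
  shows "A = A'"
proof -
  have "A *v x = A' *v x" for x
    by (rule linear_eq_on [OF matrix_vector_mul_linear matrix_vector_mul_linear _ assms, of x B])
      (simp add: B [unfolded orthonormal_basis_def])
  then show ?thesis by (simp add: matrix_eq)
qed

lemma spectral_sum_mult_basis:
  assumes b: "b \<in> B"
  shows "spectral_sum B f *v b = f b *\<^sub>R b"
proof -
  have "spectral_sum B f *v b = (\<Sum>c\<in>B. if c = b then f b *\<^sub>R b else 0)"
    unfolding spectral_sum_def matrix_vector_mult.sum_left
    by (intro sum.cong refl)
      (auto simp: matrix_vector_mult.scaleR_left outer_mult_vec inner_orthonormal_basis b)
  then show ?thesis using b by (simp add: finite_orthonormal_basis)
qed

lemma spectral_sum_mult: "spectral_sum B f ** spectral_sum B g = spectral_sum B (\<lambda>b. f b * g b)"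
  by (rule matrix_eq_on_orthonormal_basis)
    (simp add: spectral_sum_mult_basis matrix_vector_mult.scaleR_right mult.commute
      flip: matrix_vector_mul_assoc)

lemma spectral_sum_const: "spectral_sum B (\<lambda>_. c) = c *\<^sub>R mat 1"
  by (rule matrix_eq_on_orthonormal_basis)
    (simp add: spectral_sum_mult_basis matrix_vector_mult.scaleR_left)

lemma trace_eq_sum_orthonormal_basis: "trace A = (\<Sum>b\<in>B. b \<bullet> (A *v b))"
  using trace_mult_spectral_sum [of A B "\<lambda>_. 1"] by (simp add: spectral_sum_const)

lemma trace_spectral_sum: "trace (spectral_sum B f) = (\<Sum>b\<in>B. f b)"
  using trace_mult_spectral_sum [of "mat 1" B f] by (simp add: inner_orthonormal_basis)

lemma psd_mat_spectral_sum_iff: "psd_mat (spectral_sum B f) \<longleftrightarrow> (\<forall>b\<in>B. 0 \<le> f b)"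
proof
  assume psd: "psd_mat (spectral_sum B f)"
  show "\<forall>b\<in>B. 0 \<le> f b"
  proof
    fix b assume "b \<in> B"
    then have "b \<bullet> (spectral_sum B f *v b) = f b"
      by (simp add: spectral_sum_mult_basis inner_orthonormal_basis)
    with psd show "0 \<le> f b" unfolding psd_mat_def by metis
  qed
next
  assume "\<forall>b\<in>B. 0 \<le> f b"
  then show "psd_mat (spectral_sum B f)"
    by (auto simp: psd_mat_def transpose_spectral_sum inner_spectral_sum intro: sum_nonneg)
qed

lemma loewner_ge_spectral_sum_iff:
  "loewner_ge (spectral_sum B f) (c *\<^sub>R mat 1) \<longleftrightarrow> (\<forall>b\<in>B. c \<le> f b)"
  by (simp add: loewner_ge_def spectral_sum_diff psd_mat_spectral_sum_iff flip: spectral_sum_const)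

lemma eigenvalues_spectral_sum: "{l. \<exists>v. v \<noteq> 0 \<and> spectral_sum B f *v v = l *\<^sub>R v} = f ` B"
proof (intro antisym subsetI)
  fix l assume "l \<in> f ` B"
  then obtain b where "b \<in> B" "l = f b" by blast
  moreover have "b \<noteq> 0" using B \<open>b \<in> B\<close> by (auto simp: orthonormal_basis_def)
  ultimately show "l \<in> {l. \<exists>v. v \<noteq> 0 \<and> spectral_sum B f *v v = l *\<^sub>R v}"
    using spectral_sum_mult_basis by auto
next
  fix l assume "l \<in> {l. \<exists>v. v \<noteq> 0 \<and> spectral_sum B f *v v = l *\<^sub>R v}"
  then obtain v where v: "v \<noteq> 0" "spectral_sum B f *v v = l *\<^sub>R v" by blast
  obtain b where b: "b \<in> B" "b \<bullet> v \<noteq> 0"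
    using v(1) B vector_eq_dot_span [of v B 0] by (auto simp: orthonormal_basis_def)
  have "b \<bullet> (spectral_sum B f *v v) = f b * (b \<bullet> v)"
    using b by (simp add: inner_matrix_vector_mult transpose_spectral_sum spectral_sum_mult_basis)
  with b v show "l \<in> f ` B" by auto
qed

lemma lambda_min_spectral_sum: "lambda_min (spectral_sum B f) = Min (f ` B)"
  by (simp add: lambda_min_def eigenvalues_spectral_sum)

end

theorem spectral_theorem:
  fixes A :: "real^'n^'n"
  assumes "transpose A = A"
  obtains B f where "orthonormal_basis B" "A = spectral_sum B f"
proof -
  obtain B f where "orthonormal_basis B" "\<And>b. b \<in> B \<Longrightarrow> A *v b = f b *\<^sub>R b"
    using self_adjoint_orthonormal_eigenbasis [of "(*v) A"] assms
    by (metis inner_matrix_vector_mult matrix_vector_mul_linear)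
  then show thesis
    using that matrix_eq_on_orthonormal_basis [of B A] spectral_sum_mult_basis by metis
qed

section \<open>Positive semidefinite matrices\<close>

lemma psd_mat_symmetric: "psd_mat A \<Longrightarrow> transpose A = A"
  by (simp add: psd_mat_def)

lemma psd_mat_add: "psd_mat A \<Longrightarrow> psd_mat B \<Longrightarrow> psd_mat (A + B)"
  by (auto simp: psd_mat_def transpose_add matrix_vector_mult.add_left inner_add_right)

lemma psd_mat_scaleR: "psd_mat A \<Longrightarrow> 0 \<le> c \<Longrightarrow> psd_mat (c *\<^sub>R A)"
  by (auto simp: psd_mat_def transpose_scalar matrix_vector_mult.scaleR_left)

lemma psd_mat_congruence: "psd_mat A \<Longrightarrow> psd_mat (M ** A ** transpose M)"
  for M :: "real^'n^'m"
  unfolding psd_mat_def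
  by (simp add: matrix_transpose_mul matrix_mul_assoc)
    (simp add: inner_matrix_vector_mult [of _ M] flip: matrix_vector_mul_assoc)

lemma psd_mat_mult_transpose: "psd_mat (M ** transpose M)" for M :: "real^'n^'m"
  using psd_mat_congruence [of "mat 1" M] by (simp add: psd_mat_def)

lemma pd_imp_psd_mat: "pd_mat A \<Longrightarrow> psd_mat A"
  unfolding pd_mat_def psd_mat_def by (metis inner_zero_left less_imp_le order_refl)

lemma pd_mat_add: "psd_mat A \<Longrightarrow> pd_mat B \<Longrightarrow> pd_mat (A + B)"
  by (auto simp: pd_mat_def psd_mat_def transpose_add matrix_vector_mult.add_left
      inner_add_right intro: add_nonneg_pos)

lemma pd_mat_scaleR_mat_1: "0 < c \<Longrightarrow> pd_mat (c *\<^sub>R mat 1)"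
  by (auto simp: pd_mat_def transpose_scalar matrix_vector_mult.scaleR_left)

lemma trace_mult_psd_mat_nonneg:
  assumes "psd_mat A" "psd_mat B"
  shows "0 \<le> trace (A ** B)"
proof -
  obtain D f where D: "orthonormal_basis D" and B: "B = spectral_sum D f"
    using spectral_theorem [OF psd_mat_symmetric [OF assms(2)]] .
  have "0 \<le> f b * (b \<bullet> (A *v b))" if "b \<in> D" for b
    using that assms psd_mat_spectral_sum_iff [OF D] by (simp add: B psd_mat_def)
  then show ?thesis unfolding B trace_mult_spectral_sum by (rule sum_nonneg)
qed

lemma trace_psd_mat_nonneg: "psd_mat A \<Longrightarrow> 0 \<le> trace A"
  using trace_mult_psd_mat_nonneg [of A "mat 1"] by (simp add: psd_mat_def)

lemma closed_psd_mat: "closed {A :: real^'n^'n. psd_mat A}"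
proof -
  have "{A :: real^'n^'n. psd_mat A} = {A. transpose A = A} \<inter> (\<Inter>v. {A. 0 \<le> v \<bullet> (A *v v)})"
    by (auto simp: psd_mat_def)
  moreover have "closed {A :: real^'n^'n. transpose A = A}"
    by (intro closed_Collect_eq continuous_intros)
  moreover have "closed {A :: real^'n^'n. 0 \<le> v \<bullet> (A *v v)}" for v
    by (intro closed_Collect_le continuous_intros)
  ultimately show ?thesis by (simp add: closed_Int closed_INT)
qed

lemma closed_loewner_ge: "closed {A. loewner_ge A B}"
  using closed_vimage [OF closed_psd_mat, of "\<lambda>A. A - B"]
  by (simp add: loewner_ge_def vimage_def continuous_intros)

lemma loewner_ge_refl: "loewner_ge A A"
  by (simp add: loewner_ge_def psd_mat_def transpose_def vec_eq_iff)

lemma loewner_ge_antisym: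
  assumes "loewner_ge A B" "loewner_ge B A"
  shows "A = B"
proof -
  obtain D f where D: "orthonormal_basis D" and f: "A - B = spectral_sum D f"
    using spectral_theorem [OF psd_mat_symmetric [OF assms(1) [unfolded loewner_ge_def]]] .
  have "B - A = spectral_sum D (\<lambda>b. - f b)"
    using f by (simp add: spectral_sum_def sum_negf) (metis minus_diff_eq)
  then have "\<forall>b\<in>D. f b = 0"
    using assms f psd_mat_spectral_sum_iff [OF D] unfolding loewner_ge_def by force
  then have "A - B = 0" by (simp add: f spectral_sum_def)
  then show ?thesis by simp
qed

lemma loewner_ge_imp_pd_mat: "loewner_ge A (c *\<^sub>R mat 1) \<Longrightarrow> 0 < c \<Longrightarrow> pd_mat A"
  using pd_mat_add [of "A - c *\<^sub>R mat 1" "c *\<^sub>R mat 1"]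
  by (simp add: loewner_ge_def pd_mat_scaleR_mat_1)

lemma loewner_ge_lambda_min:
  assumes "transpose A = A"
  shows "loewner_ge A (lambda_min A *\<^sub>R mat 1)"
proof -
  obtain B f where B: "orthonormal_basis B" and A: "A = spectral_sum B f"
    using spectral_theorem [OF assms] .
  then show ?thesis
    by (simp add: loewner_ge_spectral_sum_iff lambda_min_spectral_sum finite_orthonormal_basis)
qed

lemma lambda_min_attained:
  fixes A :: "real^'n^'n"
  assumes "transpose A = A"
  obtains v where "v \<noteq> 0" "v \<bullet> (A *v v) = lambda_min A * (v \<bullet> v)"
proof -
  obtain B f where B: "orthonormal_basis B" and A: "A = spectral_sum B f"
    using spectral_theorem [OF assms] .
  have "B \<noteq> {}"
  proof
    assume "B = {}"
    then have "axis undefined 1 = (0 :: real^'n)" using B by (auto simp: orthonormal_basis_def)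
    then show False by (simp add: axis_eq_0_iff)
  qed
  then have "lambda_min A \<in> f ` B"
    using Min_in finite_orthonormal_basis [OF B] by (simp add: A lambda_min_spectral_sum [OF B])
  then obtain b where b: "b \<in> B" "lambda_min A = f b" by blast
  then have "b \<bullet> (A *v b) = lambda_min A * (b \<bullet> b)"
    by (simp add: A spectral_sum_mult_basis [OF B])
  moreover have "b \<noteq> 0" using B b by (auto simp: orthonormal_basis_def)
  ultimately show thesis by (intro that)
qed

lemma lambda_min_nonneg: "psd_mat A \<Longrightarrow> 0 \<le> lambda_min A"
  using lambda_min_attained [of A] unfolding psd_mat_def
  by (metis inner_gt_zero_iff zero_le_mult_iff linorder_not_less)

lemma lambda_min_pos: "pd_mat A \<Longrightarrow> 0 < lambda_min A"
  using lambda_min_attained [of A] unfolding pd_mat_def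
  by (metis inner_ge_zero linorder_not_less mult_nonpos_nonneg)

section \<open>Matrix square roots and inverses\<close>

lemma loewner_ge_if_square_loewner_ge:
  assumes A: "psd_mat A" and B: "psd_mat B" and le: "loewner_ge (A ** A) (B ** B)"
  shows "loewner_ge A B"
proof -
  have "transpose (A - B) = A - B"
    using A B by (simp add: psd_mat_def transpose_diff)
  then obtain D f where D: "orthonormal_basis D" and f: "A - B = spectral_sum D f"
    by (rule spectral_theorem)
  have "0 \<le> f b" if b: "b \<in> D" for b
  proof (rule ccontr)
    assume neg: "\<not> 0 \<le> f b"
    have diff: "A *v b - B *v b = f b *\<^sub>R b"
      using b by (simp add: f spectral_sum_mult_basis [OF D] flip: matrix_vector_mult.diff_left)
    have nonneg: "0 \<le> b \<bullet> (A *v b)" "0 \<le> b \<bullet> (B *v b)"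
      using A B by (auto simp: psd_mat_def)
    have "0 \<le> b \<bullet> ((A ** A - B ** B) *v b)"
      using le by (simp add: loewner_ge_def psd_mat_def)
    also have "\<dots> = (A *v b) \<bullet> (A *v b) - (B *v b) \<bullet> (B *v b)"
      using A B inner_matrix_vector_mult [of b A "A *v b"]
        inner_matrix_vector_mult [of b B "B *v b"]
      by (simp add: psd_mat_def matrix_vector_mult.diff_left inner_diff_right
          matrix_vector_mul_assoc)
    also have "\<dots> = (A *v b - B *v b) \<bullet> (A *v b + B *v b)"
      by (simp add: algebra_simps inner_commute)
    also have "\<dots> = f b * (b \<bullet> (A *v b) + b \<bullet> (B *v b))"
      by (simp add: diff inner_add_right distrib_left)
    finally have "b \<bullet> (A *v b) = 0" "b \<bullet> (B *v b) = 0"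
      using neg nonneg by (auto simp: zero_le_mult_iff)
    moreover have "b \<bullet> (A *v b - B *v b) = f b"
      unfolding diff using inner_orthonormal_basis [OF D b b] by simp
    ultimately show False using neg by (simp add: inner_diff_right)
  qed
  then show ?thesis by (simp add: loewner_ge_def f psd_mat_spectral_sum_iff [OF D])
qed

lemma psd_mat_square_inject:
  assumes "psd_mat A" "psd_mat B" "A ** A = B ** B"
  shows "A = B"
  using assms loewner_ge_refl
  by (intro loewner_ge_antisym loewner_ge_if_square_loewner_ge [of A B]
      loewner_ge_if_square_loewner_ge [of B A])
    simp_all

lemma msqrt_eqI: "psd_mat R \<Longrightarrow> R ** R = A \<Longrightarrow> msqrt A = R"
  unfolding msqrt_def by (rule the_equality, blast, rule psd_mat_square_inject) simp_all

lemma msqrt_spectral_sum: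
  assumes B: "orthonormal_basis B" and nonneg: "\<And>b. b \<in> B \<Longrightarrow> 0 \<le> f b"
  shows "msqrt (spectral_sum B f) = spectral_sum B (\<lambda>b. sqrt (f b))"
proof (rule msqrt_eqI)
  show "psd_mat (spectral_sum B (\<lambda>b. sqrt (f b)))"
    using nonneg by (simp add: psd_mat_spectral_sum_iff [OF B])
  show "spectral_sum B (\<lambda>b. sqrt (f b)) ** spectral_sum B (\<lambda>b. sqrt (f b)) = spectral_sum B f"
    unfolding spectral_sum_mult [OF B] using nonneg by (simp add: spectral_sum_def)
qed

lemma msqrt_properties:
  assumes "psd_mat A"
  shows psd_mat_msqrt: "psd_mat (msqrt A)"
    and msqrt_mult_self: "msqrt A ** msqrt A = A"
    and transpose_msqrt: "transpose (msqrt A) = msqrt A"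
proof -
  obtain B f where B: "orthonormal_basis B" and A: "A = spectral_sum B f"
    using spectral_theorem [OF psd_mat_symmetric [OF assms]] .
  have nonneg: "0 \<le> f b" if "b \<in> B" for b
    using assms that by (simp add: A psd_mat_spectral_sum_iff [OF B])
  then have sqrt_A: "msqrt A = spectral_sum B (\<lambda>b. sqrt (f b))"
    unfolding A by (rule msqrt_spectral_sum [OF B])
  show "psd_mat (msqrt A)"
    using nonneg by (simp add: sqrt_A psd_mat_spectral_sum_iff [OF B])
  then show "transpose (msqrt A) = msqrt A" by (rule psd_mat_symmetric)
  show "msqrt A ** msqrt A = A"
    unfolding sqrt_A spectral_sum_mult [OF B] unfolding A using nonneg
    by (simp add: spectral_sum_def)
qed

lemma mult_msqrt_mult_transpose:
  fixes M :: "real^'n^'m"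
  assumes "psd_mat A"
  shows "(M ** msqrt A) ** transpose (M ** msqrt A) = M ** A ** transpose M"
proof -
  have "(M ** msqrt A) ** transpose (M ** msqrt A) = M ** (msqrt A ** msqrt A) ** transpose M"
    by (simp add: matrix_transpose_mul transpose_msqrt assms matrix_mul_assoc)
  then show ?thesis by (simp add: msqrt_mult_self assms)
qed

lemma norm_msqrt_mult_vec:
  assumes "psd_mat A"
  shows "norm (msqrt A *v u) = sqrt (u \<bullet> (A *v u))"
  using inner_matrix_vector_mult [of u "msqrt A" "msqrt A *v u"] msqrt_properties [OF assms]
  by (simp add: norm_eq_sqrt_inner matrix_vector_mul_assoc)

lemma psd_invertible_imp_pd_mat:
  assumes "psd_mat A" "invertible A"
  shows "pd_mat A"
proof -
  have "v = 0" if "v \<bullet> (A *v v) = 0" for v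
  proof -
    have "msqrt A *v v = 0" using that norm_msqrt_mult_vec [OF assms(1), of v] by simp
    then have "msqrt A *v (msqrt A *v v) = 0" by simp
    then have "A *v v = 0" by (simp add: matrix_vector_mul_assoc msqrt_mult_self [OF assms(1)])
    then show "v = 0" using inj_matrix_vector_mult [OF assms(2)] by (auto dest: injD [where y = 0])
  qed
  then show ?thesis using assms(1) unfolding pd_mat_def psd_mat_def by (metis less_eq_real_def)
qed

lemma pd_mat_invertible: "pd_mat A \<Longrightarrow> invertible A"
  unfolding invertible_left_inverse matrix_left_invertible_ker by (force simp: pd_mat_def)

lemmas pd_mat_inv = invertible_matrix_inv [OF pd_mat_invertible]

lemma transpose_matrix_inv_pd_mat:
  assumes "pd_mat A"
  shows "transpose (matrix_inv A) = matrix_inv A"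
proof -
  have "transpose (matrix_inv A) ** A = mat 1"
    using arg_cong [OF pd_mat_inv(1) [OF assms], of transpose] assms
    by (simp add: matrix_transpose_mul pd_mat_def)
  then have "transpose (matrix_inv A) ** (A ** matrix_inv A) = matrix_inv A"
    by (simp add: matrix_mul_assoc)
  then show ?thesis by (simp add: pd_mat_inv(1) [OF assms])
qed

lemma psd_mat_matrix_inv:
  assumes "pd_mat A"
  shows "psd_mat (matrix_inv A)"
proof -
  have "psd_mat (matrix_inv A ** A ** transpose (matrix_inv A))"
    by (intro psd_mat_congruence pd_imp_psd_mat assms)
  then show ?thesis by (simp add: pd_mat_inv assms transpose_matrix_inv_pd_mat)
qed

lemma pd_mat_msqrt:
  assumes "pd_mat A"
  shows "pd_mat (msqrt A)"
proof (rule psd_invertible_imp_pd_mat)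
  note psd = pd_imp_psd_mat [OF assms]
  show "psd_mat (msqrt A)" using psd by (rule psd_mat_msqrt)
  have "(matrix_inv A ** msqrt A) ** msqrt A = mat 1"
    using pd_mat_inv(2) [OF assms] by (simp add: msqrt_mult_self psd flip: matrix_mul_assoc)
  then show "invertible (msqrt A)" unfolding invertible_left_inverse ..
qed

section \<open>The polar decomposition\<close>

lemma compact_orthogonal_matrix: "compact {K :: real^'n^'n. orthogonal_matrix K}"
proof -
  have "norm K \<le> sqrt (real CARD('n))" if "orthogonal_matrix K" for K :: "real^'n^'n"
    using that norm_matrix_eq_trace [of K]
    by (intro real_le_rsqrt) (simp add: orthogonal_matrix_def trace_I)
  then have "bounded {K :: real^'n^'n. orthogonal_matrix K}"
    by (auto simp: bounded_iff)
  moreover have "closed {K :: real^'n^'n. orthogonal_matrix K}"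
    unfolding orthogonal_matrix by (intro closed_Collect_eq continuous_intros)
  ultimately show ?thesis by (simp add: compact_eq_bounded_closed)
qed

definition householder :: "real^'n \<Rightarrow> real^'n^'n" where
  "householder v = mat 1 - (2 / (v \<bullet> v)) *\<^sub>R outer v"

lemma orthogonal_matrix_householder: "orthogonal_matrix (householder v)"
proof -
  have "outer v ** outer v = (v \<bullet> v) *\<^sub>R outer v"
    by (simp add: matrix_eq outer_mult_vec matrix_vector_mult.scaleR_left
        matrix_vector_mult.scaleR_right flip: matrix_vector_mul_assoc)
  then show ?thesis
    by (cases "v = 0")
      (simp_all add: householder_def orthogonal_matrix transpose_diff transpose_scalar
        transpose_outer matrix_mult_distribs scaleR_2)
qed

lemma trace_mult_householder:
  "trace (A ** householder v) = trace A - 2 / (v \<bullet> v) * (v \<bullet> (A *v v))"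
  by (simp add: householder_def matrix_mult_distribs trace_sub trace_scaleR trace_mult_outer)

lemma trace_mult_householder_householder:
  assumes "norm v = 1"
  shows "trace (A ** (householder v ** householder w))
    = trace A - 2 * (v \<bullet> (A *v v)) - 2 / (w \<bullet> w) * (w \<bullet> (A *v w) - 2 * (v \<bullet> w) * (w \<bullet> (A *v v)))"
  using assms
  by (simp add: matrix_mul_assoc trace_mult_householder)
    (simp add: householder_def norm_eq_1 matrix_mult_distribs outer_mult_vec
      matrix_vector_mult.diff_left matrix_vector_mult.scaleR_left matrix_vector_mult.scaleR_right
      inner_diff_right algebra_simps flip: matrix_vector_mul_assoc)

text \<open>The trace is stationary along the rotations \<open>householder v ** householder (v + t *\<^sub>R w)\<close>
  in the plane of \<open>v\<close> and \<open>w\<close>.\<close>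

lemma bilinear_form_commute_if_trace_maximal:
  fixes A :: "real^'n^'n"
  assumes maximal: "\<And>K. orthogonal_matrix K \<Longrightarrow> trace (A ** K) \<le> trace A"
    and unit: "norm v = 1" "norm w = 1" and perp: "v \<bullet> w = 0"
  shows "v \<bullet> (A *v w) = w \<bullet> (A *v v)"
proof -
  have "v \<bullet> (A *v w) - w \<bullet> (A *v v) = 0"
  proof (rule quadratic_nonneg_imp_linear_coeff_0)
    fix t :: real
    define z where "z = v + t *\<^sub>R w"
    have z: "z \<bullet> z = 1 + t\<^sup>2" "v \<bullet> z = 1"
      using unit perp
      by (simp_all add: z_def norm_eq_1 algebra_simps inner_commute power2_eq_square)
    have "trace (A ** (householder v ** householder z)) \<le> trace A"
      by (intro maximal orthogonal_matrix_mul orthogonal_matrix_householder)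
    then have "0 \<le> 2 * (v \<bullet> (A *v v)) + (2 * (z \<bullet> (A *v z)) - 4 * (z \<bullet> (A *v v))) / (1 + t\<^sup>2)"
      using unit z by (simp add: trace_mult_householder_householder)
    then have "2 * (z \<bullet> (A *v v)) \<le> (1 + t\<^sup>2) * (v \<bullet> (A *v v)) + z \<bullet> (A *v z)"
      using sum_power2_gt_zero_iff [of 1 t] by (simp add: field_simps)
    then show "0 \<le> 2 * t * (v \<bullet> (A *v w) - w \<bullet> (A *v v)) + t\<^sup>2 * (2 * (v \<bullet> (A *v v) + w \<bullet> (A *v w)))"
      by (simp add: z_def matrix_vector_mult.add_right matrix_vector_mult.scaleR_right
          algebra_simps power2_eq_square)
  qed
  then show ?thesis by simp
qed

lemma psd_mat_if_trace_maximal: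
  fixes A :: "real^'n^'n"
  assumes maximal: "\<And>K. orthogonal_matrix K \<Longrightarrow> trace (A ** K) \<le> trace A"
  shows "psd_mat A"
proof -
  have "0 \<le> v \<bullet> (A *v v)" for v
  proof (cases "v = 0")
    case False
    have "0 \<le> 2 / (v \<bullet> v) * (v \<bullet> (A *v v))"
      using maximal [OF orthogonal_matrix_householder [of v]] by (simp add: trace_mult_householder)
    from mult_nonneg_nonneg [OF inner_ge_zero [of v] this] show ?thesis using False by simp
  qed simp
  moreover have "A $ i $ j = A $ j $ i" for i j
  proof (cases "i = j")
    case False
    then have "axis i 1 \<bullet> (axis j 1 :: real^'n) = 0" by (simp add: inner_axis_axis)
    from bilinear_form_commute_if_trace_maximal [OF maximal norm_axis_1 norm_axis_1 this]
    show ?thesis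
      by (simp add: matrix_vector_mult_basis inner_axis' column_def)
  qed simp
  then have "transpose A = A" by (simp add: transpose_def vec_eq_iff)
  ultimately show ?thesis by (simp add: psd_mat_def)
qed

lemma right_polar_decomposition:
  fixes A :: "real^'n^'n"
  obtains K where "orthogonal_matrix K" "psd_mat (A ** K)"
proof -
  let ?O = "{K :: real^'n^'n. orthogonal_matrix K}"
  have "?O \<noteq> {}" using orthogonal_matrix_id by blast
  moreover have "continuous_on ?O (\<lambda>K. trace (A ** K))" by (intro continuous_intros)
  ultimately obtain K where K: "orthogonal_matrix K"
    and maximal: "\<And>L. orthogonal_matrix L \<Longrightarrow> trace (A ** L) \<le> trace (A ** K)"
    using continuous_attains_sup [OF compact_orthogonal_matrix] by blast
  have "psd_mat (A ** K)"
    using maximal orthogonal_matrix_mul [OF K]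
    by (intro psd_mat_if_trace_maximal) (simp flip: matrix_mul_assoc)
  with K that show thesis by blast
qed

section \<open>Fidelity and the Gelbrich distance\<close>

definition fidelity :: "real^'n^'n \<Rightarrow> real^'n^'n \<Rightarrow> real" where
  "fidelity S S0 = trace (msqrt (msqrt S0 ** S ** msqrt S0))"

lemma fidelity_eq_sum_norm:
  fixes S S0 :: "real^'n^'n"
  assumes S: "psd_mat S" and S0: "psd_mat S0"
  obtains B where "orthonormal_basis B"
    "fidelity S S0 = (\<Sum>b\<in>B. norm (msqrt S *v (msqrt S0 *v b)))"
proof -
  let ?R = "msqrt S0"
  have psd: "psd_mat (?R ** S ** ?R)"
    using psd_mat_congruence [OF S, of ?R] by (simp add: transpose_msqrt S0)
  obtain B f where B: "orthonormal_basis B" and f: "?R ** S ** ?R = spectral_sum B f"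
    using spectral_theorem [OF psd_mat_symmetric [OF psd]] .
  have nonneg: "0 \<le> f b" if "b \<in> B" for b
    using psd that by (simp add: f psd_mat_spectral_sum_iff [OF B])
  have "norm (msqrt S *v (?R *v b)) = sqrt (f b)" if b: "b \<in> B" for b
  proof -
    have "(?R *v b) \<bullet> (S *v (?R *v b)) = b \<bullet> ((?R ** S ** ?R) *v b)"
      by (simp add: inner_matrix_vector_mult [of b ?R] transpose_msqrt S0
          flip: matrix_vector_mul_assoc)
    also have "\<dots> = f b"
      using inner_orthonormal_basis [OF B b b] by (simp add: f spectral_sum_mult_basis [OF B b])
    finally show ?thesis by (simp add: norm_msqrt_mult_vec [OF S])
  qed
  then have "fidelity S S0 = (\<Sum>b\<in>B. norm (msqrt S *v (?R *v b)))"
    by (simp add: fidelity_def f msqrt_spectral_sum [OF B nonneg] trace_spectral_sum [OF B])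
  with B that show thesis by blast
qed

lemma norm_psd_mult_vec_le:
  assumes "psd_mat R" "0 \<le> e"
  shows "norm (R *v w) \<le> norm ((R + e *\<^sub>R mat 1) *v w)"
proof -
  have "(R *v w) \<bullet> (R *v w) \<le> (R *v w) \<bullet> (R *v w) + 2 * e * (w \<bullet> (R *v w)) + e\<^sup>2 * (w \<bullet> w)"
    using assms by (simp add: psd_mat_def)
  also have "\<dots> = ((R + e *\<^sub>R mat 1) *v w) \<bullet> ((R + e *\<^sub>R mat 1) *v w)"
    by (simp add: matrix_vector_mult.add_left matrix_vector_mult.scaleR_left
        algebra_simps inner_commute power2_eq_square)
  finally show ?thesis by (simp add: norm_le)
qed

text \<open>Conjugation by \<open>msqrt S0 + e\<close> preserves the trace of \<open>C\<close> and makes the second factor of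
  the bound at most 1.\<close>

lemma trace_le_sum_norm:
  fixes C S S0 :: "real^'n^'n"
  assumes S: "psd_mat S" and S0: "psd_mat S0" and e: "0 < e" and B: "orthonormal_basis B"
    and bound: "\<And>u v. u \<bullet> (C *v v) \<le> sqrt (u \<bullet> (S *v u)) * sqrt (v \<bullet> (S0 *v v))"
  shows "trace C \<le> (\<Sum>b\<in>B. norm (msqrt S *v ((msqrt S0 + e *\<^sub>R mat 1) *v b)))"
proof -
  define R where "R = msqrt S0 + e *\<^sub>R mat 1"
  have R: "pd_mat R" unfolding R_def by (intro pd_mat_add psd_mat_msqrt S0 pd_mat_scaleR_mat_1 e)
  have term_le: "(R *v b) \<bullet> (C *v (matrix_inv R *v b)) \<le> norm (msqrt S *v (R *v b))"
    if b: "b \<in> B" for b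
  proof -
    let ?w = "matrix_inv R *v b"
    have "norm (msqrt S0 *v ?w) \<le> norm (R *v ?w)"
      unfolding R_def using e by (intro norm_psd_mult_vec_le psd_mat_msqrt S0) simp
    also have "\<dots> = 1"
      using pd_mat_inv(1) [OF R] B b by (simp add: matrix_vector_mul_assoc orthonormal_basis_def)
    finally have "norm (msqrt S *v (R *v b)) * norm (msqrt S0 *v ?w) \<le> norm (msqrt S *v (R *v b))"
      by (rule mult_left_le) simp
    with bound [of "R *v b" ?w] show ?thesis
      by (simp add: norm_msqrt_mult_vec S S0)
  qed
  have "trace C = trace (R ** C ** matrix_inv R)"
    using trace_mul_sym [of "R ** C" "matrix_inv R"] pd_mat_inv(2) [OF R]
    by (simp add: matrix_mul_assoc)
  also have "\<dots> = (\<Sum>b\<in>B. (R *v b) \<bullet> (C *v (matrix_inv R *v b)))"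
    using R by (simp add: trace_eq_sum_orthonormal_basis [OF B] inner_matrix_vector_mult [of _ R]
        pd_mat_def flip: matrix_vector_mul_assoc)
  also have "\<dots> \<le> (\<Sum>b\<in>B. norm (msqrt S *v (R *v b)))" by (rule sum_mono) (rule term_le)
  finally show ?thesis by (simp add: R_def)
qed

lemma trace_le_fidelity:
  fixes C S S0 :: "real^'n^'n"
  assumes S: "psd_mat S" and S0: "psd_mat S0"
    and bound: "\<And>u v. u \<bullet> (C *v v) \<le> sqrt (u \<bullet> (S *v u)) * sqrt (v \<bullet> (S0 *v v))"
  shows "trace C \<le> fidelity S S0"
proof -
  obtain B where B: "orthonormal_basis B"
    "fidelity S S0 = (\<Sum>b\<in>B. norm (msqrt S *v (msqrt S0 *v b)))"
    by (rule fidelity_eq_sum_norm [OF S S0])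
  define g where "g e = (\<Sum>b\<in>B. norm (msqrt S *v ((msqrt S0 + e *\<^sub>R mat 1) *v b)))" for e
  have "\<forall>\<^sub>F e in at_right 0. trace C \<le> g e"
    using eventually_at_right_less [of "0 :: real"]
    by (rule eventually_mono) (simp add: g_def trace_le_sum_norm [OF S S0 _ B(1) bound])
  moreover have "(g \<longlongrightarrow> g 0) (at_right 0)"
  proof -
    have "continuous_on UNIV g" unfolding g_def by (intro continuous_intros)
    then show ?thesis
      by (simp add: continuous_on_eq_continuous_at continuous_at_imp_continuous_at_within
          flip: continuous_within)
  qed
  ultimately have "trace C \<le> g 0"
    using tendsto_lowerbound [OF _ _ trivial_limit_at_right_real] by blast
  then show ?thesis by (simp add: g_def B(2))
qed

lemma inner_msqrt_le_fidelity:
  fixes X S0 :: "real^'n^'n"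
  assumes S0: "psd_mat S0"
  shows "X \<bullet> msqrt S0 \<le> fidelity (X ** transpose X) S0"
proof -
  have "trace (X ** msqrt S0) \<le> fidelity (X ** transpose X) S0"
  proof (rule trace_le_fidelity [OF psd_mat_mult_transpose S0])
    fix u v :: "real^'n"
    have "u \<bullet> ((X ** msqrt S0) *v v) = (transpose X *v u) \<bullet> (msqrt S0 *v v)"
      by (simp add: inner_matrix_vector_mult flip: matrix_vector_mul_assoc)
    also have "\<dots> \<le> norm (transpose X *v u) * norm (msqrt S0 *v v)"
      by (rule norm_cauchy_schwarz)
    also have "norm (transpose X *v u) = sqrt (u \<bullet> ((X ** transpose X) *v u))"
      by (simp add: norm_eq_sqrt_inner inner_matrix_vector_mult [of u X]
          flip: matrix_vector_mul_assoc)
    finally show "u \<bullet> ((X ** msqrt S0) *v v)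
      \<le> sqrt (u \<bullet> ((X ** transpose X) *v u)) * sqrt (v \<bullet> (S0 *v v))"
      by (simp add: norm_msqrt_mult_vec S0)
  qed
  then show ?thesis by (simp add: inner_symmetric_eq_trace transpose_msqrt S0)
qed

lemma msqrt_orthogonal_mult_transpose:
  assumes "psd_mat S" "orthogonal_matrix K"
  shows "(msqrt S ** K) ** transpose (msqrt S ** K) = S"
proof -
  have "(msqrt S ** K) ** transpose (msqrt S ** K) = msqrt S ** (K ** transpose K) ** msqrt S"
    by (simp add: matrix_transpose_mul transpose_msqrt assms(1) matrix_mul_assoc)
  then show ?thesis
    using assms by (simp add: orthogonal_matrix_def msqrt_mult_self)
qed

lemma fidelity_attained:
  fixes S S0 :: "real^'n^'n"
  assumes S: "psd_mat S" and S0: "psd_mat S0"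
  obtains K where "orthogonal_matrix K" "(msqrt S ** K) \<bullet> msqrt S0 = fidelity S S0"
proof -
  obtain K where K: "orthogonal_matrix K" and psd: "psd_mat (msqrt S0 ** msqrt S ** K)"
    by (rule right_polar_decomposition)
  let ?P = "msqrt S0 ** msqrt S ** K"
  have "?P ** ?P = ?P ** transpose ?P"
    using psd_mat_symmetric [OF psd] by simp
  also have "\<dots> = msqrt S0 ** ((msqrt S ** K) ** transpose (msqrt S ** K)) ** msqrt S0"
    by (simp add: matrix_transpose_mul transpose_msqrt S0 matrix_mul_assoc)
  finally have "msqrt (msqrt S0 ** S ** msqrt S0) = ?P"
    by (intro msqrt_eqI psd) (simp add: msqrt_orthogonal_mult_transpose S K)
  then have "fidelity S S0 = msqrt S0 \<bullet> (msqrt S ** K)"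
    by (simp add: fidelity_def inner_matrix_eq_trace transpose_msqrt S0 matrix_mul_assoc)
  with K that show thesis by (simp add: inner_commute)
qed

lemma fidelity_commute:
  assumes S: "psd_mat S" and S0: "psd_mat S0"
  shows "fidelity S S0 = fidelity S0 S"
proof -
  have "fidelity S S0 \<le> fidelity S0 S"
    if S: "psd_mat S" and S0: "psd_mat S0" for S S0 :: "real^'n^'n"
  proof -
    obtain K where K: "orthogonal_matrix K"
      and attained: "(msqrt S ** K) \<bullet> msqrt S0 = fidelity S S0"
      by (rule fidelity_attained [OF S S0])
    have "fidelity S S0 = (msqrt S ** K) \<bullet> msqrt S0" by (rule attained [symmetric])
    also have "\<dots> = trace ((K ** msqrt S0) ** msqrt S)"
      using trace_mul_sym [of "msqrt S" "K ** msqrt S0"]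
      by (simp add: inner_symmetric_eq_trace transpose_msqrt S0 matrix_mul_assoc)
    also have "\<dots> = (msqrt S0 ** transpose K) \<bullet> msqrt S"
      by (simp add: inner_matrix_eq_trace matrix_transpose_mul transpose_msqrt S0)
    also have "\<dots> \<le> fidelity ((msqrt S0 ** transpose K) ** transpose (msqrt S0 ** transpose K)) S"
      by (rule inner_msqrt_le_fidelity [OF S])
    finally show ?thesis
      using K by (simp add: msqrt_orthogonal_mult_transpose [OF S0])
  qed
  with S S0 show ?thesis by (intro antisym)
qed

lemma gelbrich_sq_eq_fidelity: "gelbrich_sq S S0 = trace S + trace S0 - 2 * fidelity S S0"
  by (simp add: gelbrich_sq_def fidelity_def trace_add trace_sub trace_scaleR)

lemma norm_diff_msqrt:
  assumes "psd_mat S0"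
  shows "(norm (X - msqrt S0))\<^sup>2 = trace (X ** transpose X) + trace S0 - 2 * (X \<bullet> msqrt S0)"
  using norm_matrix_eq_trace [of X] norm_matrix_eq_trace [of "msqrt S0"] msqrt_properties [OF assms]
  by (simp add: power2_norm_eq_inner algebra_simps inner_commute)

lemma gelbrich_sq_le_norm:
  assumes "psd_mat S0"
  shows "gelbrich_sq (X ** transpose X) S0 \<le> (norm (X - msqrt S0))\<^sup>2"
  using inner_msqrt_le_fidelity [OF assms, of X]
  by (simp add: gelbrich_sq_eq_fidelity norm_diff_msqrt [OF assms])

lemma gelbrich_sq_attained:
  assumes S: "psd_mat S" and S0: "psd_mat S0"
  obtains K where "orthogonal_matrix K" "gelbrich_sq S S0 = (norm (msqrt S ** K - msqrt S0))\<^sup>2"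
proof -
  obtain K where "orthogonal_matrix K" "(msqrt S ** K) \<bullet> msqrt S0 = fidelity S S0"
    by (rule fidelity_attained [OF S S0])
  then show thesis
    using that
    by (simp add: gelbrich_sq_eq_fidelity norm_diff_msqrt [OF S0]
        msqrt_orthogonal_mult_transpose [OF S])
qed

lemma gelbrich_sq_nonneg: "psd_mat S \<Longrightarrow> psd_mat S0 \<Longrightarrow> 0 \<le> gelbrich_sq S S0"
  by (metis gelbrich_sq_attained zero_le_power2)

lemma gelbrich_sq_self: "psd_mat S \<Longrightarrow> gelbrich_sq S S = 0"
  using gelbrich_sq_le_norm [of S "msqrt S"] gelbrich_sq_nonneg [of S S]
  by (simp add: msqrt_properties)

lemma gelbrich_ball_eq_image_cball:
  fixes S0 :: "real^'n^'n"
  assumes S0: "psd_mat S0" and r: "0 \<le> r"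
  shows "{S. psd_mat S \<and> gelbrich_sq S S0 \<le> r\<^sup>2} = (\<lambda>X. X ** transpose X) ` cball (msqrt S0) r"
proof (intro antisym subsetI)
  fix S assume "S \<in> {S. psd_mat S \<and> gelbrich_sq S S0 \<le> r\<^sup>2}"
  then have S: "psd_mat S" "gelbrich_sq S S0 \<le> r\<^sup>2" by simp_all
  obtain K where K: "orthogonal_matrix K" "gelbrich_sq S S0 = (norm (msqrt S ** K - msqrt S0))\<^sup>2"
    by (rule gelbrich_sq_attained [OF S(1) S0])
  then have "msqrt S ** K \<in> cball (msqrt S0) r"
    using S(2) r by (auto simp: dist_norm norm_minus_commute intro: power2_le_imp_le)
  then show "S \<in> (\<lambda>X. X ** transpose X) ` cball (msqrt S0) r"
    by (rule rev_image_eqI) (simp add: msqrt_orthogonal_mult_transpose S K)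
next
  fix S assume "S \<in> (\<lambda>X. X ** transpose X) ` cball (msqrt S0) r"
  then obtain X where X: "S = X ** transpose X" "norm (X - msqrt S0) \<le> r"
    by (auto simp: dist_norm norm_minus_commute)
  then have "gelbrich_sq S S0 \<le> r\<^sup>2"
    using gelbrich_sq_le_norm [OF S0, of X] power_mono [OF X(2), of 2] by simp
  then show "S \<in> {S. psd_mat S \<and> gelbrich_sq S S0 \<le> r\<^sup>2}"
    by (simp add: X(1) psd_mat_mult_transpose)
qed

lemma compact_gelbrich_ball:
  assumes "psd_mat S0" "0 \<le> r"
  shows "compact {S. psd_mat S \<and> gelbrich_sq S S0 \<le> r\<^sup>2}"
  unfolding gelbrich_ball_eq_image_cball [OF assms]
  by (intro compact_continuous_image compact_cball continuous_intros)

section \<open>Dominating elements of Gelbrich balls\<close>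

lemma fidelity_weak_duality:
  fixes J S S0 :: "real^'n^'n"
  assumes J: "pd_mat J" and S: "psd_mat S" and S0: "psd_mat S0"
  shows "2 * fidelity S S0 \<le> trace (J ** S) + trace (matrix_inv J ** S0)"
proof -
  obtain K where K: "orthogonal_matrix K" and X: "(msqrt S ** K) \<bullet> msqrt S0 = fidelity S S0"
    by (rule fidelity_attained [OF S S0])
  let ?X = "msqrt S ** K" and ?R = "msqrt S0" and ?I = "matrix_inv J"
  note J' = pd_mat_inv [OF J] pd_imp_psd_mat [OF J, THEN psd_mat_symmetric]
  have "0 \<le> trace (?I ** ((J ** ?X - ?R) ** transpose (J ** ?X - ?R)))"
    by (intro trace_mult_psd_mat_nonneg psd_mat_matrix_inv J psd_mat_mult_transpose)
  also have "?I ** ((J ** ?X - ?R) ** transpose (J ** ?X - ?R))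
      = (?I ** J) ** (?X ** transpose ?X) ** J - (?I ** J) ** ?X ** ?R
        - ?I ** ?R ** transpose ?X ** J + ?I ** (?R ** ?R)"
    by (simp add: transpose_diff matrix_transpose_mul matrix_mult_distribs matrix_mul_assoc J'
        transpose_msqrt S0)
  also have "trace \<dots>
      = trace (S ** J) - trace (?X ** ?R) - trace (?I ** ?R ** transpose ?X ** J)
        + trace (?I ** S0)"
    using K
    by (simp add: J' msqrt_orthogonal_mult_transpose S msqrt_mult_self S0 trace_add trace_sub)
  also have "trace (?I ** ?R ** transpose ?X ** J) = ?X \<bullet> ?R"
    using trace_mul_sym [of "?I ** ?R ** transpose ?X" J] trace_mul_sym [of ?R "transpose ?X"]
    by (simp add: matrix_mul_assoc J' inner_matrix_eq_trace)
  also have "trace (?X ** ?R) = ?X \<bullet> ?R"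
    by (simp add: inner_symmetric_eq_trace transpose_msqrt S0)
  also have "trace (S ** J) = trace (J ** S)" by (rule trace_mul_sym)
  finally show ?thesis by (simp add: X)
qed

lemma fidelity_congruence:
  assumes S: "psd_mat S" and J: "psd_mat J"
  shows "fidelity S (J ** S ** J) = trace (J ** S)"
proof -
  let ?Q = "msqrt S"
  have QJQ: "psd_mat (?Q ** J ** ?Q)"
    using psd_mat_congruence [OF J, of ?Q] by (simp add: transpose_msqrt S)
  have "(?Q ** J ** ?Q) ** (?Q ** J ** ?Q) = ?Q ** J ** (?Q ** ?Q) ** J ** ?Q"
    by (simp only: matrix_mul_assoc)
  then have "msqrt (?Q ** (J ** S ** J) ** ?Q) = ?Q ** J ** ?Q"
    by (intro msqrt_eqI QJQ) (simp add: msqrt_mult_self S matrix_mul_assoc)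
  moreover have JSJ: "psd_mat (J ** S ** J)"
    using psd_mat_congruence [OF S, of J] by (simp add: psd_mat_symmetric [OF J])
  ultimately have "fidelity S (J ** S ** J) = trace ((?Q ** J) ** ?Q)"
    unfolding fidelity_commute [OF S JSJ] by (simp add: fidelity_def)
  also have "\<dots> = trace (J ** S)"
    using trace_mul_sym [of "?Q ** J" ?Q] trace_mul_sym [of S J]
    by (simp add: matrix_mul_assoc msqrt_mult_self S)
  finally show ?thesis .
qed

lemma riccati_solution_exists:
  assumes S: "pd_mat S" and S0: "pd_mat S0"
  obtains J where "pd_mat J" "J ** S ** J = S0"
proof -
  define Q where "Q = msqrt S"
  have Q: "pd_mat Q" "Q ** Q = S" "transpose Q = Q"
    using pd_mat_msqrt [OF S] msqrt_properties [OF pd_imp_psd_mat [OF S]] by (simp_all add: Q_def)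
  define I where "I = matrix_inv Q"
  have I: "I ** Q = mat 1" "Q ** I = mat 1" "transpose I = I"
    using pd_mat_inv [OF Q(1)] transpose_matrix_inv_pd_mat [OF Q(1)] by (simp_all add: I_def)
  define N where "N = msqrt (Q ** S0 ** Q)"
  have "psd_mat (Q ** S0 ** Q)"
    using psd_mat_congruence [OF pd_imp_psd_mat [OF S0], of Q] Q by simp
  then have N: "psd_mat N" "N ** N = Q ** S0 ** Q" by (simp_all add: N_def msqrt_properties)
  let ?J = "I ** N ** I"
  have "?J ** S ** ?J = I ** N ** (I ** Q) ** (Q ** I) ** N ** I"
    by (simp add: matrix_mul_assoc flip: Q(2))
  also have "\<dots> = I ** (N ** N) ** I" by (simp add: I matrix_mul_assoc)
  also have "\<dots> = (I ** Q) ** S0 ** (Q ** I)" by (simp add: N(2) matrix_mul_assoc)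
  finally have J: "?J ** S ** ?J = S0" by (simp add: I)
  have "psd_mat ?J" using psd_mat_congruence [OF N(1), of I] I by simp
  moreover have "(matrix_inv S0 ** ?J ** S) ** ?J = mat 1"
    using pd_mat_inv(2) [OF S0] J by (simp flip: matrix_mul_assoc)
  then have "invertible ?J" unfolding invertible_left_inverse ..
  ultimately show thesis using that J by (blast intro: psd_invertible_imp_pd_mat)
qed

lemma riccati_solution_ge:
  assumes J: "psd_mat J" and S: "psd_mat S" and ge: "loewner_ge (J ** S ** J) (c *\<^sub>R mat 1)"
    and c: "0 < c"
    and v: "msqrt S *v v = sqrt c *\<^sub>R v"
  shows "v \<bullet> v \<le> v \<bullet> (J *v v)"
proof -
  define Q where "Q = msqrt S"
  have Q: "psd_mat Q" "transpose Q = Q" "Q ** Q = S"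
    using msqrt_properties [OF S] by (simp_all add: Q_def)
  have "loewner_ge (Q ** J ** Q) (sqrt c *\<^sub>R Q)"
  proof (rule loewner_ge_if_square_loewner_ge)
    show "psd_mat (Q ** J ** Q)" using psd_mat_congruence [OF J, of Q] Q by simp
    show "psd_mat (sqrt c *\<^sub>R Q)" using Q c by (simp add: psd_mat_scaleR)
    have "psd_mat (Q ** (J ** S ** J - c *\<^sub>R mat 1) ** transpose Q)"
      using ge unfolding loewner_ge_def by (rule psd_mat_congruence)
    then show "loewner_ge ((Q ** J ** Q) ** (Q ** J ** Q)) ((sqrt c *\<^sub>R Q) ** (sqrt c *\<^sub>R Q))"
      using c by (simp add: loewner_ge_def Q(2) matrix_mult_distribs matrix_mul_assoc flip: Q(3))
  qed
  then have "sqrt c * (v \<bullet> (Q *v v)) \<le> v \<bullet> ((Q ** J ** Q) *v v)"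
    by (simp add: loewner_ge_def psd_mat_def matrix_vector_mult.diff_left
        matrix_vector_mult.scaleR_left inner_diff_right)
  also have "\<dots> = (Q *v v) \<bullet> (J *v (Q *v v))"
    by (simp add: inner_matrix_vector_mult [of v Q] Q(2) flip: matrix_vector_mul_assoc)
  finally have "c * (v \<bullet> v) \<le> c * (v \<bullet> (J *v v))"
    using v c by (simp add: Q_def [symmetric] matrix_vector_mult.scaleR_right)
  then show ?thesis using c by simp
qed

lemma gelbrich_sq_subgradient:
  assumes S': "psd_mat S'" and S: "psd_mat S" and J: "pd_mat J"
  shows "trace ((J - mat 1) ** (S' - S))
    \<le> gelbrich_sq S (J ** S' ** J) - gelbrich_sq S' (J ** S' ** J)"
proof -
  note J' = pd_imp_psd_mat [OF J]
  have "psd_mat (J ** S' ** J)"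
    using psd_mat_congruence [OF S', of J] by (simp add: psd_mat_symmetric [OF J'])
  then have "2 * fidelity S (J ** S' ** J)
    \<le> trace (J ** S) + trace (matrix_inv J ** (J ** S' ** J))"
    by (rule fidelity_weak_duality [OF J S])
  also have "trace (matrix_inv J ** (J ** S' ** J)) = trace (J ** S')"
    using pd_mat_inv(2) [OF J] trace_mul_sym [of S' J] by (simp add: matrix_mul_assoc)
  finally show ?thesis
    by (simp add: gelbrich_sq_eq_fidelity fidelity_congruence [OF S' J'] matrix_mult_distribs
        trace_sub)
qed

text \<open>Raise the eigenvalues of \<open>S\<close> below \<open>c\<close> to \<open>c\<close>. The subgradient of the Gelbrich distance at
  the new matrix is nonnegative on the eigenvectors that were raised.\<close>

lemma gelbrich_ball_dominated:
  fixes S S0 :: "real^'n^'n"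
  assumes S: "psd_mat S" and ge: "loewner_ge S0 (c *\<^sub>R mat 1)" and "0 \<le> c"
  obtains S' where "psd_mat S'" "loewner_ge S' S" "loewner_ge S' (c *\<^sub>R mat 1)"
    "gelbrich_sq S' S0 \<le> gelbrich_sq S S0"
proof (cases "c = 0")
  case True
  then have "loewner_ge S (c *\<^sub>R mat 1)" using S by (simp add: loewner_ge_def)
  with that S loewner_ge_refl show thesis by blast
next
  case False
  with \<open>0 \<le> c\<close> have c: "0 < c" by simp
  obtain B f where B: "orthonormal_basis B" and f: "S = spectral_sum B f"
    using spectral_theorem [OF psd_mat_symmetric [OF S]] .
  define S' where "S' = spectral_sum B (\<lambda>b. max c (f b))"
  have diff: "S' - S = spectral_sum B (\<lambda>b. max c (f b) - f b)"
    by (simp add: S'_def f spectral_sum_diff)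
  have S'_ge: "loewner_ge S' (c *\<^sub>R mat 1)"
    by (simp add: S'_def loewner_ge_spectral_sum_iff [OF B])
  have pd: "pd_mat S'" "pd_mat S0" using S'_ge ge c by (auto intro: loewner_ge_imp_pd_mat)
  note psd = pd_imp_psd_mat [OF pd(1)]
  obtain J where J: "pd_mat J" "J ** S' ** J = S0"
    by (rule riccati_solution_exists [OF pd])
  have "0 \<le> (max c (f b) - f b) * (b \<bullet> ((J - mat 1) *v b))" if b: "b \<in> B" for b
  proof (cases "f b < c")
    case True
    have "msqrt S' *v b = sqrt c *\<^sub>R b"
      using c b True unfolding S'_def
      by (subst msqrt_spectral_sum [OF B]) (auto simp: spectral_sum_mult_basis [OF B])
    then have "b \<bullet> b \<le> b \<bullet> (J *v b)"
      using ge
      by (intro riccati_solution_ge [OF pd_imp_psd_mat [OF J(1)] psd _ c]) (simp_all add: J)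
    then show ?thesis using True by (simp add: matrix_vector_mult.diff_left inner_diff_right)
  qed simp
  then have "0 \<le> trace ((J - mat 1) ** (S' - S))"
    unfolding diff trace_mult_spectral_sum by (rule sum_nonneg)
  also have "\<dots> \<le> gelbrich_sq S S0 - gelbrich_sq S' S0"
    using gelbrich_sq_subgradient [OF psd S J(1)] by (simp add: J(2))
  finally have "gelbrich_sq S' S0 \<le> gelbrich_sq S S0" by simp
  moreover have "loewner_ge S' S"
    by (simp add: loewner_ge_def diff psd_mat_spectral_sum_iff [OF B])
  ultimately show thesis using that psd S'_ge by blast
qed

section \<open>Invariance of Lebesgue measure under orthogonal transformations\<close>

definition translation_invariant :: "'a::euclidean_space measure \<Rightarrow> bool" where
  "translation_invariant M \<longleftrightarrow>
    sigma_finite_measure M \<and> sets M = sets borel \<and> (\<forall>c. distr M borel ((+) c) = M)"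

lemma nn_integral_translation:
  assumes M: "translation_invariant M" and [measurable]: "h \<in> borel_measurable borel"
  shows "(\<integral>\<^sup>+x. h (c + x) \<partial>M) = (\<integral>\<^sup>+x. h x \<partial>M)"
proof -
  have [measurable_cong]: "sets M = sets borel" using M by (simp add: translation_invariant_def)
  have "(\<integral>\<^sup>+x. h x \<partial>distr M borel ((+) c)) = (\<integral>\<^sup>+x. h (c + x) \<partial>M)"
    by (rule nn_integral_distr) measurable
  then show ?thesis using M by (simp add: translation_invariant_def)
qed

text \<open>Both sides are the double integral of \<open>N (x - y) * g y\<close>.\<close>

lemma nn_integral_translation_invariant_exchange:
  fixes L M :: "'a::euclidean_space measure"
  assumes L: "translation_invariant L" and M: "translation_invariant M"
    and [measurable]: "N \<in> borel_measurable borel" "g \<in> borel_measurable borel"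
  shows "(\<integral>\<^sup>+x. N x \<partial>L) * (\<integral>\<^sup>+y. g y \<partial>M) = (\<integral>\<^sup>+y. N (- y) \<partial>M) * (\<integral>\<^sup>+x. g x \<partial>L)"
proof -
  have [measurable_cong]: "sets L = sets borel" "sets M = sets borel"
    using L M by (simp_all add: translation_invariant_def)
  interpret L: sigma_finite_measure L using L by (simp add: translation_invariant_def)
  interpret M: sigma_finite_measure M using M by (simp add: translation_invariant_def)
  interpret pair_sigma_finite L M ..
  have "(\<integral>\<^sup>+x. N x \<partial>L) * (\<integral>\<^sup>+y. g y \<partial>M) = (\<integral>\<^sup>+y. (\<integral>\<^sup>+x. N x \<partial>L) * g y \<partial>M)"
    by (rule nn_integral_cmult [symmetric]) measurable
  also have "\<dots> = (\<integral>\<^sup>+y. (\<integral>\<^sup>+x. N (x - y) * g y \<partial>L) \<partial>M)"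
  proof (rule nn_integral_cong)
    fix y
    show "(\<integral>\<^sup>+x. N x \<partial>L) * g y = (\<integral>\<^sup>+x. N (x - y) * g y \<partial>L)"
      using nn_integral_translation [OF L, of N "- y"] by (simp add: nn_integral_multc)
  qed
  also have "\<dots> = (\<integral>\<^sup>+x. (\<integral>\<^sup>+y. N (x - y) * g y \<partial>M) \<partial>L)"
    by (rule Fubini') measurable
  also have "\<dots> = (\<integral>\<^sup>+x. (\<integral>\<^sup>+y. N (- y) * g (x + y) \<partial>M) \<partial>L)"
  proof (rule nn_integral_cong)
    fix x
    have "(\<integral>\<^sup>+y. N (x - (x + y)) * g (x + y) \<partial>M) = (\<integral>\<^sup>+y. N (x - y) * g y \<partial>M)"
      by (rule nn_integral_translation [OF M]) measurable
    then show "(\<integral>\<^sup>+y. N (x - y) * g y \<partial>M) = (\<integral>\<^sup>+y. N (- y) * g (x + y) \<partial>M)" by simp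
  qed
  also have "\<dots> = (\<integral>\<^sup>+y. (\<integral>\<^sup>+x. N (- y) * g (x + y) \<partial>L) \<partial>M)"
    by (rule Fubini' [symmetric]) measurable
  also have "\<dots> = (\<integral>\<^sup>+y. N (- y) * (\<integral>\<^sup>+x. g x \<partial>L) \<partial>M)"
  proof (rule nn_integral_cong)
    fix y
    show "(\<integral>\<^sup>+x. N (- y) * g (x + y) \<partial>L) = N (- y) * (\<integral>\<^sup>+x. g x \<partial>L)"
      using nn_integral_translation [OF L, of g y] by (simp add: nn_integral_cmult add.commute)
  qed
  also have "\<dots> = (\<integral>\<^sup>+y. N (- y) \<partial>M) * (\<integral>\<^sup>+x. g x \<partial>L)"
    by (rule nn_integral_multc) measurable
  finally show ?thesis .
qed

lemma translation_invariant_lborel: "translation_invariant lborel"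
  by (simp add: translation_invariant_def sigma_finite_lborel lborel_distr_plus)

lemma translation_invariant_eq_lborel:
  fixes M :: "'a::euclidean_space measure"
  assumes M: "translation_invariant M"
    and ball: "emeasure M (cball 0 1) = emeasure lborel (cball (0::'a) 1)"
  shows "M = lborel"
proof (rule measure_eqI)
  show sets: "sets M = sets lborel" using M by (simp add: translation_invariant_def)
  fix A assume "A \<in> sets M"
  then have A: "A \<in> sets borel" by (simp add: sets)
  define V where "V = emeasure lborel (cball (0::'a) 1)"
  have V: "V \<noteq> 0" "V \<noteq> \<top>"
    using content_cball_pos [of 1 "0 :: 'a"] emeasure_lborel_cball_finite [of "0 :: 'a" 1]
    unfolding V_def by (auto simp: measure_def)
  have "indicator (cball 0 1) (- y) = (indicator (cball 0 1) y :: ennreal)" for y :: 'a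
    by (simp add: indicator_def)
  then have "V * emeasure M A = V * emeasure lborel A"
    using nn_integral_translation_invariant_exchange
      [OF translation_invariant_lborel M, of "indicator (cball 0 1)" "indicator A"] A
    by (simp add: V_def ball sets borel_measurable_indicator)
  then show "emeasure M A = emeasure lborel A" using V by (simp add: ennreal_mult_cancel_left)
qed

lemma borel_measurable_linear:
  fixes f :: "'a::euclidean_space \<Rightarrow> 'b::euclidean_space"
  assumes "linear f"
  shows "f \<in> borel_measurable borel"
  using assms by (intro borel_measurable_continuous_onI linear_continuous_on)
    (simp add: linear_conv_bounded_linear)

lemma borel_measurable_orthogonal_transformation:
  "orthogonal_transformation f \<Longrightarrow> f \<in> borel_measurable borel" for f :: "'a::euclidean_space \<Rightarrow> 'a"
  by (intro borel_measurable_linear orthogonal_transformation_linear)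

lemma lborel_distr_orthogonal_transformation:
  fixes f :: "'a::euclidean_space \<Rightarrow> 'a"
  assumes f: "orthogonal_transformation f"
  shows "distr lborel borel f = lborel"
proof (rule translation_invariant_eq_lborel)
  note [measurable] = borel_measurable_orthogonal_transformation [OF f]
    borel_measurable_orthogonal_transformation [OF orthogonal_transformation_inv [OF f]]
  have inv_f: "inv f (f x) = x" "f (inv f x) = x" for x
    using orthogonal_transformation_bij [OF f]
    by (simp_all add: bij_is_inj bij_is_surj surj_f_inv_f)
  have "distr (distr lborel borel f) borel (inv f) = (lborel :: 'a measure)"
    by (simp add: distr_distr o_def inv_f distr_id2)
  then have "sigma_finite_measure (distr (distr lborel borel f) borel (inv f))"
    by (simp add: sigma_finite_lborel)
  then have "sigma_finite_measure (distr lborel borel f)"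
    by (rule sigma_finite_measure_distr) measurable
  moreover have "distr (distr lborel borel f) borel ((+) c) = distr lborel borel f" for c
  proof -
    have "(+) c \<circ> f = f \<circ> (+) (inv f c)"
      by (simp add: fun_eq_iff linear_add [OF orthogonal_transformation_linear [OF f]] inv_f)
    then have "distr (distr lborel borel f) borel ((+) c)
      = distr (distr lborel borel ((+) (inv f c))) borel f"
      by (simp add: distr_distr)
    then show ?thesis by (simp add: lborel_distr_plus)
  qed
  ultimately show "translation_invariant (distr lborel borel f)"
    by (simp add: translation_invariant_def)
  show "emeasure (distr lborel borel f) (cball 0 1) = emeasure lborel (cball (0::'a) 1)"
    by (subst emeasure_distr)
      (simp_all add: vimage_def dist_norm orthogonal_transformation_norm [OF f] cball_def)
qed

section \<open>The standard normal law on a Euclidean space\<close>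

definition std_normal :: "'a::euclidean_space measure" where
  "std_normal = density lborel (\<lambda>z. ennreal (\<Prod>b\<in>Basis. std_normal_density (z \<bullet> b)))"

lemma prod_std_normal_density:
  "(\<Prod>b\<in>Basis. std_normal_density (z \<bullet> b))
    = (1 / sqrt (2 * pi)) ^ DIM('a) * exp (- (norm z)\<^sup>2 / 2)" for z :: "'a::euclidean_space"
proof -
  have "(\<Prod>b\<in>Basis. std_normal_density (z \<bullet> b))
      = (1 / sqrt (2 * pi)) ^ DIM('a) * exp (\<Sum>b\<in>Basis. - (z \<bullet> b)\<^sup>2 / 2)"
    by (simp add: std_normal_density_def prod.distrib prod_dividef power_divide exp_sum)
  also have "(\<Sum>b\<in>Basis. - (z \<bullet> b)\<^sup>2 / 2) = - (norm z)\<^sup>2 / 2"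
    unfolding power2_norm_eq_inner
    by (subst euclidean_inner) (simp add: sum_negf power2_eq_square flip: sum_divide_distrib)
  finally show ?thesis .
qed

lemma sets_std_normal [simp, measurable_cong]: "sets std_normal = sets borel"
  by (simp add: std_normal_def)

lemma space_std_normal [simp]: "space std_normal = UNIV"
  by (simp add: std_normal_def)

lemma distr_std_normal_orthogonal_transformation:
  fixes f :: "'a::euclidean_space \<Rightarrow> 'a"
  assumes f: "orthogonal_transformation f"
  shows "distr std_normal borel f = std_normal"
proof -
  have "distr std_normal borel f
      = distr (density lborel (\<lambda>z. ennreal (\<Prod>b\<in>Basis. std_normal_density (f z \<bullet> b)))) borel f"
    by (simp add: std_normal_def prod_std_normal_density orthogonal_transformation_norm [OF f])
  also have "\<dots>
    = density (distr lborel borel f) (\<lambda>z. ennreal (\<Prod>b\<in>Basis. std_normal_density (z \<bullet> b)))"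
    using borel_measurable_orthogonal_transformation [OF f] by (subst density_distr) simp_all
  finally show ?thesis by (simp add: lborel_distr_orthogonal_transformation [OF f] std_normal_def)
qed

lemma integral_std_normal_orthogonal_transformation:
  fixes f :: "'a::euclidean_space \<Rightarrow> 'a" and h :: "'a \<Rightarrow> real"
  assumes f: "orthogonal_transformation f" and [measurable]: "h \<in> borel_measurable borel"
  shows "(\<integral>z. h (f z) \<partial>std_normal) = (\<integral>z. h z \<partial>std_normal)"
proof -
  note [measurable] = borel_measurable_orthogonal_transformation [OF f]
  have "(\<integral>z. h z \<partial>distr std_normal borel f) = (\<integral>z. h (f z) \<partial>std_normal)"
    by (rule integral_distr) simp_all
  then show ?thesis by (simp add: distr_std_normal_orthogonal_transformation [OF f])
qed

lemma nn_integral_std_normal_density: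
  "(\<integral>\<^sup>+x. ennreal (std_normal_density x) \<partial>lborel) = 1"
  "(\<integral>\<^sup>+x. ennreal (std_normal_density x) * ennreal (x\<^sup>2) \<partial>lborel) = 1"
proof -
  have "has_bochner_integral lborel (\<lambda>x. std_normal_density x) 1"
    using std_normal_moment_even [of 0] by simp
  then show "(\<integral>\<^sup>+x. ennreal (std_normal_density x) \<partial>lborel) = 1"
    by (simp add: has_bochner_integral_iff nn_integral_eq_integral)
  have "has_bochner_integral lborel (\<lambda>x. std_normal_density x * x\<^sup>2) 1"
    using std_normal_moment_even [of 1] by (simp add: fact_numeral)
  then have "(\<integral>\<^sup>+x. ennreal (std_normal_density x * x\<^sup>2) \<partial>lborel) = 1"
    by (subst nn_integral_eq_integral) (auto simp: has_bochner_integral_iff)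
  then show "(\<integral>\<^sup>+x. ennreal (std_normal_density x) * ennreal (x\<^sup>2) \<partial>lborel) = 1"
    by (simp add: ennreal_mult)
qed

lemma nn_integral_std_normal_prod:
  fixes h :: "'a::euclidean_space \<Rightarrow> real \<Rightarrow> ennreal"
  assumes [measurable]: "\<And>b. b \<in> Basis \<Longrightarrow> h b \<in> borel_measurable borel"
  shows "(\<integral>\<^sup>+z. (\<Prod>b\<in>Basis. h b (z \<bullet> b)) \<partial>std_normal)
    = (\<Prod>b\<in>Basis. \<integral>\<^sup>+x. ennreal (std_normal_density x) * h b x \<partial>lborel)"
proof -
  have "(\<integral>\<^sup>+z. (\<Prod>b\<in>Basis. h b (z \<bullet> b)) \<partial>std_normal)
      = (\<integral>\<^sup>+z. (\<Prod>b\<in>Basis. ennreal (std_normal_density (z \<bullet> b)) * h b (z \<bullet> b)) \<partial>lborel)"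
    unfolding std_normal_def
    by (subst nn_integral_density) (simp_all add: prod.distrib prod_ennreal)
  also have "\<dots> = (\<Prod>b\<in>Basis. \<integral>\<^sup>+x. ennreal (std_normal_density x) * h b x \<partial>lborel)"
    by (subst nn_integral_lborel_prod [of "\<lambda>b x. ennreal (std_normal_density x) * h b x"]) simp_all
  finally show ?thesis .
qed

lemma prob_space_std_normal: "prob_space (std_normal :: 'a::euclidean_space measure)"
proof
  show "emeasure std_normal (space (std_normal :: 'a measure)) = 1"
    using nn_integral_std_normal_prod [of "\<lambda>(_ :: 'a) _. 1"]
    by (simp add: nn_integral_std_normal_density)
qed

lemma std_normal_Basis_square:
  fixes b :: "'a::euclidean_space"
  assumes b: "b \<in> Basis"
  shows "integrable std_normal (\<lambda>z. (z \<bullet> b)\<^sup>2)" "(\<integral>z. (z \<bullet> b)\<^sup>2 \<partial>std_normal) = 1"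
proof -
  let ?h = "\<lambda>c x. if c = b then ennreal (x\<^sup>2) else 1"
  have "(\<integral>\<^sup>+z. ennreal ((z \<bullet> b)\<^sup>2) \<partial>std_normal) = (\<integral>\<^sup>+z. (\<Prod>c\<in>Basis. ?h c (z \<bullet> c)) \<partial>std_normal)"
    using b by (simp add: prod.delta)
  also have "\<dots> = (\<Prod>c\<in>(Basis :: 'a set). \<integral>\<^sup>+x. ennreal (std_normal_density x) * ?h c x \<partial>lborel)"
    by (rule nn_integral_std_normal_prod) auto
  also have "\<dots> = 1"
  proof (intro prod.neutral ballI)
    show "(\<integral>\<^sup>+x. ennreal (std_normal_density x) * ?h c x \<partial>lborel) = 1" for c
      by (cases "c = b") (simp_all add: nn_integral_std_normal_density)
  qed
  finally have nn_integral: "(\<integral>\<^sup>+z. ennreal ((z \<bullet> b)\<^sup>2) \<partial>std_normal) = 1" .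
  then show "integrable std_normal (\<lambda>z. (z \<bullet> b)\<^sup>2)"
    by (intro integrableI_nonneg) auto
  show "(\<integral>z. (z \<bullet> b)\<^sup>2 \<partial>std_normal) = 1"
    by (subst integral_eq_nn_integral) (simp_all add: nn_integral)
qed

lemma integrable_std_normal_norm_square: "integrable std_normal (\<lambda>z. (norm z)\<^sup>2)"
proof -
  have "(norm z)\<^sup>2 = (\<Sum>b\<in>Basis. (z \<bullet> b)\<^sup>2)" for z :: 'a
    unfolding power2_norm_eq_inner by (subst euclidean_inner) (simp add: power2_eq_square)
  then show ?thesis by (simp add: Bochner_Integration.integrable_sum std_normal_Basis_square)
qed

section \<open>Maps of linear growth\<close>

definition linear_growth :: "('a::euclidean_space \<Rightarrow> 'b::euclidean_space) \<Rightarrow> bool" where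
  "linear_growth f \<longleftrightarrow> f \<in> borel_measurable borel \<and> (\<exists>C. \<forall>x. norm (f x) \<le> C * (1 + norm x))"

lemma estimators_eq: "estimators = {\<psi>. linear_growth \<psi>}"
proof -
  have "\<exists>C>0. \<forall>x. norm (\<psi> x) \<le> C * (1 + norm x)"
    if "\<And>x. norm (\<psi> x) \<le> C * (1 + norm x)" for \<psi> :: "real^'m \<Rightarrow> real^'n" and C
  proof (intro exI conjI allI)
    show "norm (\<psi> x) \<le> max C 1 * (1 + norm x)" for x
      using that [of x] by (rule order_trans) (simp add: mult_right_mono)
  qed simp
  then show ?thesis unfolding estimators_def linear_growth_def by blast
qed

lemma linear_growth_measurable [measurable_dest]: "linear_growth f \<Longrightarrow> f \<in> borel_measurable borel"
  by (simp add: linear_growth_def)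

lemma linear_growth_const: "linear_growth (\<lambda>_. c)"
proof -
  have "norm c \<le> norm c * (1 + norm x)" for x :: 'a by (simp add: distrib_left)
  then show ?thesis by (auto simp: linear_growth_def)
qed

lemma linear_growth_linear:
  assumes "linear f"
  shows "linear_growth f"
proof -
  obtain K where K: "0 < K" "\<And>x. norm (f x) \<le> norm x * K"
    using assms bounded_linear.pos_bounded by (auto simp: linear_conv_bounded_linear)
  have "norm (f x) \<le> K * (1 + norm x)" for x
    by (rule order_trans [OF K(2)]) (use K(1) in \<open>simp add: algebra_simps\<close>)
  with borel_measurable_linear [OF assms] show ?thesis by (auto simp: linear_growth_def)
qed

lemma linear_growth_add:
  assumes "linear_growth f" "linear_growth g"
  shows "linear_growth (\<lambda>x. f x + g x)"
proof -
  obtain C D where "norm (f x) \<le> C * (1 + norm x)" "norm (g x) \<le> D * (1 + norm x)" for x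
    using assms unfolding linear_growth_def by blast
  then have "norm (f x + g x) \<le> (C + D) * (1 + norm x)" for x
    by (simp add: distrib_right norm_triangle_mono)
  moreover have "(\<lambda>x. f x + g x) \<in> borel_measurable borel"
    using assms by (intro borel_measurable_add linear_growth_measurable)
  ultimately show ?thesis unfolding linear_growth_def by blast
qed

lemma linear_growth_compose:
  assumes f: "linear_growth f" and g: "linear_growth g"
  shows "linear_growth (\<lambda>x. f (g x))"
proof -
  obtain C D where C: "norm (f y) \<le> C * (1 + norm y)" and D: "norm (g x) \<le> D * (1 + norm x)" for x y
    using assms unfolding linear_growth_def by blast
  have "norm (f (g x)) \<le> (\<bar>C\<bar> * (1 + \<bar>D\<bar>)) * (1 + norm x)" for x
  proof -
    have "norm (g x) \<le> \<bar>D\<bar> * (1 + norm x)"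
      using D [of x] by (rule order_trans) (simp add: mult_right_mono)
    then have "1 + norm (g x) \<le> (1 + norm x) + \<bar>D\<bar> * (1 + norm x)"
      by (intro add_mono) simp_all
    then have "1 + norm (g x) \<le> (1 + \<bar>D\<bar>) * (1 + norm x)"
      by (simp add: distrib_right)
    have "norm (f (g x)) \<le> \<bar>C\<bar> * (1 + norm (g x))"
      using C [of "g x"] by (rule order_trans) (simp add: mult_right_mono)
    also have "\<dots> \<le> \<bar>C\<bar> * ((1 + \<bar>D\<bar>) * (1 + norm x))"
      by (rule mult_left_mono) (fact, simp)
    finally show ?thesis by (simp add: mult.assoc)
  qed
  moreover have "(\<lambda>x. f (g x)) \<in> borel_measurable borel"
    using f g by (intro measurable_compose [of g borel borel f borel] linear_growth_measurable)
  ultimately show ?thesis unfolding linear_growth_def by blast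
qed

lemma linear_growth_diff: "linear_growth f \<Longrightarrow> linear_growth g \<Longrightarrow> linear_growth (\<lambda>x. f x - g x)"
  using linear_growth_add [of f "\<lambda>x. - g x"]
    linear_growth_compose [OF linear_growth_linear [OF linear_uminus], of g] by simp

lemma integrable_std_normal_norm_square_linear_growth:
  assumes "linear_growth f"
  shows "integrable std_normal (\<lambda>z. (norm (f z))\<^sup>2)"
proof -
  interpret prob_space std_normal by (rule prob_space_std_normal)
  obtain C where C: "norm (f z) \<le> C * (1 + norm z)" for z
    using assms unfolding linear_growth_def by blast
  have "(norm (f z))\<^sup>2 \<le> 2 * C\<^sup>2 + 2 * C\<^sup>2 * (norm z)\<^sup>2" for z
  proof -
    have "(norm (f z))\<^sup>2 \<le> (C + C * norm z)\<^sup>2"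
      using C [of z] by (intro power_mono) (simp_all add: distrib_left)
    also have "\<dots> \<le> 2 * C\<^sup>2 + 2 * (C * norm z)\<^sup>2"
      using sum_squares_bound [of C "C * norm z"] by (simp add: power2_sum)
    finally show ?thesis by (simp add: power_mult_distrib)
  qed
  then have bound: "norm ((norm (f z))\<^sup>2) \<le> norm (2 * C\<^sup>2 + 2 * C\<^sup>2 * (norm z)\<^sup>2)" for z
    by (auto intro: order_trans [OF _ abs_ge_self])
  have "integrable std_normal (\<lambda>z. 2 * C\<^sup>2 + 2 * C\<^sup>2 * (norm z)\<^sup>2)"
    by (intro Bochner_Integration.integrable_add integrable_const integrable_mult_right
        integrable_std_normal_norm_square)
  then show ?thesis
    by (rule Bochner_Integration.integrable_bound)
      (use bound linear_growth_measurable [OF assms] in simp_all)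
qed

lemma integrable_std_normal_inner_linear_growth:
  assumes "linear_growth f" "linear_growth g"
  shows "integrable std_normal (\<lambda>z. f z \<bullet> g z)"
  unfolding dot_norm using assms
  by (intro integrable_divide Bochner_Integration.integrable_diff
      integrable_std_normal_norm_square_linear_growth linear_growth_add)

section \<open>Uncorrelated linear images of the standard normal law\<close>

lemma subspace_reflection:
  fixes V :: "'a::euclidean_space set"
  assumes V: "subspace V"
  obtains f where "orthogonal_transformation f" "\<And>z. f z + z \<in> V"
    "\<And>z v. v \<in> V \<Longrightarrow> orthogonal v (f z - z)"
proof -
  obtain B where B: "B \<subseteq> V" "pairwise orthogonal B" "span B = V"
    using orthogonal_spanningset_subspace [OF V] .
  define proj where "proj z = (\<Sum>b\<in>B. (b \<bullet> z / (b \<bullet> b)) *\<^sub>R b)" for z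
  have proj_in: "proj z \<in> V" for z
    unfolding proj_def using B V by (intro subspace_sum subspace_scale) auto
  have proj_orth: "v \<bullet> (z - proj z) = 0" if "v \<in> V" for v z
    using Gram_Schmidt_step [of B v z] that B by (simp add: proj_def orthogonal_def)
  define f where "f z = 2 *\<^sub>R proj z - z" for z
  have "linear proj"
    by (auto simp: linear_iff proj_def inner_add_right add_divide_distrib algebra_simps
        sum.distrib scaleR_right.sum)
  then have "linear f" by (auto simp: linear_iff f_def algebra_simps)
  moreover have "f z \<bullet> f z = z \<bullet> z" for z
    using proj_orth [OF proj_in, of z z] by (simp add: f_def algebra_simps inner_commute)
  ultimately have "orthogonal_transformation f"
    by (simp add: orthogonal_transformation norm_eq_sqrt_inner)
  moreover have "f z + z \<in> V" for z
    using subspace_scale [OF V proj_in] by (simp add: f_def)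
  moreover have "orthogonal v (f z - z)" if "v \<in> V" for v z
    using proj_orth [OF that, of z] by (simp add: f_def orthogonal_def algebra_simps)
  ultimately show thesis using that by blast
qed

text \<open>The reflection fixing the range of \<open>adjoint Y\<close> preserves \<open>Y\<close> and flips the sign of \<open>e\<close>.\<close>

lemma integral_std_normal_uncorrelated:
  fixes Y :: "'a::euclidean_space \<Rightarrow> 'b::euclidean_space" and e :: "'a \<Rightarrow> 'c::euclidean_space"
  assumes Y: "linear Y" and e: "linear e" and uncorrelated: "\<And>u. e (adjoint Y u) = 0"
    and [measurable]: "\<phi> \<in> borel_measurable borel"
  shows "(\<integral>z. e z \<bullet> \<phi> (Y z) \<partial>std_normal) = 0"
proof -
  note [measurable] = borel_measurable_linear [OF Y] borel_measurable_linear [OF e]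
  have "subspace (range (adjoint Y))"
    using linear_subspace_image [OF adjoint_linear [OF Y] subspace_UNIV] .
  then obtain f where f: "orthogonal_transformation f" "\<And>z. f z + z \<in> range (adjoint Y)"
    "\<And>z v. v \<in> range (adjoint Y) \<Longrightarrow> orthogonal v (f z - z)"
    by (rule subspace_reflection) blast
  have "Y (f z) = Y z" for z
  proof -
    have "u \<bullet> Y (f z - z) = 0" for u
      using f(3) [OF rangeI, of u z] adjoint_works [OF Y, of "f z - z" u]
      by (simp add: orthogonal_def inner_commute)
    then have "Y (f z - z) = 0" by (metis inner_eq_zero_iff)
    then show ?thesis by (simp add: linear_diff [OF Y])
  qed
  moreover have "e (f z) = - e z" for z
  proof -
    obtain u where "f z + z = adjoint Y u" using f(2) by blast
    then have "e (f z + z) = 0" by (simp add: uncorrelated)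
    then show ?thesis by (simp add: linear_add [OF e] eq_neg_iff_add_eq_0)
  qed
  moreover have "(\<integral>z. e (f z) \<bullet> \<phi> (Y (f z)) \<partial>std_normal) = (\<integral>z. e z \<bullet> \<phi> (Y z) \<partial>std_normal)"
    by (rule integral_std_normal_orthogonal_transformation [OF f(1), of "\<lambda>z. e z \<bullet> \<phi> (Y z)"])
        measurable
  ultimately show ?thesis by simp
qed

lemma integral_std_normal_norm_add_square:
  fixes Y :: "'a::euclidean_space \<Rightarrow> 'b::euclidean_space" and e :: "'a \<Rightarrow> 'c::euclidean_space"
  assumes Y: "linear Y" and e: "linear e" and uncorrelated: "\<And>u. e (adjoint Y u) = 0"
    and \<phi>: "linear_growth \<phi>"
  shows "(\<integral>z. (norm (e z + \<phi> (Y z)))\<^sup>2 \<partial>std_normal)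
    = (\<integral>z. (norm (e z))\<^sup>2 \<partial>std_normal) + (\<integral>z. (norm (\<phi> (Y z)))\<^sup>2 \<partial>std_normal)"
proof -
  note growth = linear_growth_linear [OF e] linear_growth_compose [OF \<phi> linear_growth_linear [OF Y]]
  have "(norm (e z + \<phi> (Y z)))\<^sup>2 = (norm (e z))\<^sup>2 + (norm (\<phi> (Y z)))\<^sup>2 + 2 * (e z \<bullet> \<phi> (Y z))" for z
    by (simp add: power2_norm_eq_inner inner_add_left inner_add_right inner_commute)
  moreover have "(\<integral>z. e z \<bullet> \<phi> (Y z) \<partial>std_normal) = 0"
    by (rule integral_std_normal_uncorrelated [OF Y e uncorrelated linear_growth_measurable [OF \<phi>]])
  ultimately show ?thesis
    using growth by (simp add: integrable_std_normal_norm_square_linear_growth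
        integrable_std_normal_inner_linear_growth)
qed

lemma integral_std_normal_inner:
  fixes u w :: "'a::euclidean_space"
  shows "(\<integral>z. (z \<bullet> u) * (z \<bullet> w) \<partial>std_normal) = u \<bullet> w"
proof -
  have linear: "linear (\<lambda>z :: 'a. z \<bullet> v)" for v by (simp add: linear_iff inner_add_left)
  have Basis: "(\<integral>z. (z \<bullet> b) * (z \<bullet> c) \<partial>std_normal) = b \<bullet> c"
    if b: "b \<in> Basis" and c: "c \<in> Basis" for b c :: 'a
  proof (cases "b = c")
    case True
    with b std_normal_Basis_square(2) [OF b] show ?thesis by (simp add: power2_eq_square)
  next
    case False
    have "adjoint (\<lambda>z. z \<bullet> c) = (\<lambda>r. r *\<^sub>R c)"
      by (rule adjoint_unique) (simp add: inner_commute)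
    then have "(\<integral>z. (z \<bullet> b) \<bullet> (z \<bullet> c) \<partial>std_normal) = 0"
      using b c False
      by (intro integral_std_normal_uncorrelated [OF linear linear, where \<phi> = "\<lambda>x. x"])
        (simp_all add: inner_not_same_Basis)
    with b c False show ?thesis by (simp add: inner_not_same_Basis)
  qed
  have "(\<integral>z. (z \<bullet> u) * (z \<bullet> w) \<partial>std_normal)
      = (\<integral>z. (\<Sum>b\<in>Basis. \<Sum>c\<in>Basis. (u \<bullet> b) * (w \<bullet> c) * ((z \<bullet> b) * (z \<bullet> c))) \<partial>std_normal)"
    by (subst euclidean_inner [of _ u], subst euclidean_inner [of _ w])
      (simp add: sum_product algebra_simps)
  also have "\<dots> = (\<Sum>b\<in>Basis. \<Sum>c\<in>Basis. (u \<bullet> b) * (w \<bullet> c) * (b \<bullet> c))"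
    using integrable_std_normal_inner_linear_growth
        [OF linear_growth_linear [OF linear] linear_growth_linear [OF linear]]
    by (simp add: Basis)
  also have "\<dots> = (\<Sum>b\<in>Basis. \<Sum>c\<in>Basis. if c = b then (u \<bullet> b) * (w \<bullet> b) else 0)"
    by (intro sum.cong refl) (auto simp: inner_Basis)
  also have "\<dots> = u \<bullet> w"
    by (subst euclidean_inner) simp
  finally show ?thesis .
qed

section \<open>The Gelbrich bound\<close>

lemma integrable_mult_of_square_integrable:
  fixes f g :: "'a \<Rightarrow> real"
  assumes [measurable]: "f \<in> borel_measurable M" "g \<in> borel_measurable M"
    and squares: "integrable M (\<lambda>x. (f x)\<^sup>2)" "integrable M (\<lambda>x. (g x)\<^sup>2)"
  shows "integrable M (\<lambda>x. f x * g x)"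
proof (rule Bochner_Integration.integrable_bound)
  show "integrable M (\<lambda>x. (f x)\<^sup>2 + (g x)\<^sup>2)" using squares by simp
  have "\<bar>a * b\<bar> \<le> a\<^sup>2 + b\<^sup>2" for a b :: real
    using sum_squares_bound [of a b] sum_squares_bound [of "- a" b] by (auto simp: abs_le_iff)
  then show "AE x in M. norm (f x * g x) \<le> norm ((f x)\<^sup>2 + (g x)\<^sup>2)" by simp
qed measurable

lemma integral_Cauchy_Schwarz:
  fixes f g :: "'a \<Rightarrow> real"
  assumes [measurable]: "f \<in> borel_measurable M" "g \<in> borel_measurable M"
    and squares: "integrable M (\<lambda>x. (f x)\<^sup>2)" "integrable M (\<lambda>x. (g x)\<^sup>2)"
  shows "(\<integral>x. f x * g x \<partial>M) \<le> sqrt (\<integral>x. (f x)\<^sup>2 \<partial>M) * sqrt (\<integral>x. (g x)\<^sup>2 \<partial>M)"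
proof -
  let ?I = "\<integral>x. f x * g x \<partial>M" and ?F = "\<integral>x. (f x)\<^sup>2 \<partial>M" and ?G = "\<integral>x. (g x)\<^sup>2 \<partial>M"
  have "ennreal \<bar>?I\<bar> \<le> (\<integral>\<^sup>+x. ennreal \<bar>f x\<bar> * ennreal \<bar>g x\<bar> \<partial>M)"
    using integral_norm_bound_ennreal [OF integrable_mult_of_square_integrable [OF assms]]
    by (simp add: abs_mult ennreal_mult)
  then have "(ennreal \<bar>?I\<bar>)\<^sup>2 \<le> (\<integral>\<^sup>+x. ennreal \<bar>f x\<bar> * ennreal \<bar>g x\<bar> \<partial>M)\<^sup>2"
    by (rule power_mono) simp
  also have "\<dots> \<le> (\<integral>\<^sup>+x. (ennreal \<bar>f x\<bar>)\<^sup>2 \<partial>M) * (\<integral>\<^sup>+x. (ennreal \<bar>g x\<bar>)\<^sup>2 \<partial>M)"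
    by (rule Cauchy_Schwarz_nn_integral) measurable
  also have "\<dots> = ennreal ?F * ennreal ?G"
    using squares by (simp add: ennreal_power nn_integral_eq_integral)
  finally have "?I\<^sup>2 \<le> ?F * ?G"
    by (simp add: ennreal_power flip: ennreal_mult)
  then show ?thesis by (simp add: real_le_rsqrt flip: real_sqrt_mult)
qed

definition second_moment :: "'a measure \<Rightarrow> ('a \<Rightarrow> real^'d) \<Rightarrow> real^'d^'d \<Rightarrow> bool" where
  "second_moment M X S \<longleftrightarrow> X \<in> borel_measurable M \<and>
    (\<forall>u. integrable M (\<lambda>\<omega>. (u \<bullet> X \<omega>)\<^sup>2) \<and> (\<integral>\<omega>. (u \<bullet> X \<omega>)\<^sup>2 \<partial>M) = u \<bullet> (S *v u))"

lemma second_moment_measurable: "second_moment M X S \<Longrightarrow> X \<in> borel_measurable M"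
  by (simp add: second_moment_def)

lemma second_moment_distr_iff:
  assumes [measurable]: "f \<in> measurable M N" "X \<in> borel_measurable N"
  shows "second_moment (distr M N f) X S \<longleftrightarrow> second_moment M (\<lambda>\<omega>. X (f \<omega>)) S"
  by (simp add: second_moment_def integrable_distr_eq integral_distr)

lemma second_moment_norm_square:
  assumes "second_moment M X S"
  shows "integrable M (\<lambda>\<omega>. (norm (X \<omega>))\<^sup>2)" "(\<integral>\<omega>. (norm (X \<omega>))\<^sup>2 \<partial>M) = trace S"
proof -
  have norm: "(norm (X \<omega>))\<^sup>2 = (\<Sum>i\<in>UNIV. (axis i 1 \<bullet> X \<omega>)\<^sup>2)" for \<omega>
    unfolding power2_norm_eq_inner
    by (simp add: inner_vec_def [of "X \<omega>" "X \<omega>"] inner_axis' power2_eq_square)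
  show "integrable M (\<lambda>\<omega>. (norm (X \<omega>))\<^sup>2)"
    using assms unfolding norm second_moment_def by simp
  have "trace S = (\<Sum>i\<in>UNIV. axis i 1 \<bullet> (S *v axis i 1))"
    by (simp add: trace_def matrix_vector_mult_basis inner_axis' column_def)
  then show "(\<integral>\<omega>. (norm (X \<omega>))\<^sup>2 \<partial>M) = trace S"
    using assms unfolding norm second_moment_def by simp
qed

lemma cross_moment_matrix_exists:
  fixes X Y :: "'a \<Rightarrow> real^'d"
  assumes X: "second_moment M X S" and Y: "second_moment M Y S0"
  obtains C where "\<And>u v. u \<bullet> (C *v v) = (\<integral>\<omega>. (u \<bullet> X \<omega>) * (v \<bullet> Y \<omega>) \<partial>M)"
    "integrable M (\<lambda>\<omega>. X \<omega> \<bullet> Y \<omega>)" "trace C = (\<integral>\<omega>. X \<omega> \<bullet> Y \<omega> \<partial>M)"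
proof -
  note [measurable] = second_moment_measurable [OF X] second_moment_measurable [OF Y]
  have cross: "integrable M (\<lambda>\<omega>. (u \<bullet> X \<omega>) * (v \<bullet> Y \<omega>))" for u v
    using X Y by (intro integrable_mult_of_square_integrable) (simp_all add: second_moment_def)
  have inner: "X \<omega> \<bullet> Y \<omega> = (\<Sum>i\<in>UNIV. (axis i 1 \<bullet> X \<omega>) * (axis i 1 \<bullet> Y \<omega>))" for \<omega>
    by (simp add: inner_vec_def [of "X \<omega>" "Y \<omega>"] inner_axis')
  define C where "C = (\<chi> i j. \<integral>\<omega>. (axis i 1 \<bullet> X \<omega>) * (axis j 1 \<bullet> Y \<omega>) \<partial>M)"
  show thesis
  proof
    show "u \<bullet> (C *v v) = (\<integral>\<omega>. (u \<bullet> X \<omega>) * (v \<bullet> Y \<omega>) \<partial>M)" for u v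
    proof -
      have "(u \<bullet> X \<omega>) * (v \<bullet> Y \<omega>)
          = (\<Sum>i\<in>UNIV. \<Sum>j\<in>UNIV. u $ i * v $ j * ((axis i 1 \<bullet> X \<omega>) * (axis j 1 \<bullet> Y \<omega>)))" for \<omega>
        by (simp add: inner_vec_def [of u] inner_vec_def [of v] inner_axis' sum_product
            algebra_simps)
      then show ?thesis
        using cross
        by (simp add: C_def inner_vec_def [of u] matrix_vector_mult_def sum_distrib_left mult_ac)
    qed
    show "integrable M (\<lambda>\<omega>. X \<omega> \<bullet> Y \<omega>)" unfolding inner using cross by simp
    show "trace C = (\<integral>\<omega>. X \<omega> \<bullet> Y \<omega> \<partial>M)" using cross by (simp add: C_def trace_def inner)
  qed
qed

theorem gelbrich_bound:
  fixes X Y :: "'a \<Rightarrow> real^'d"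
  assumes S: "psd_mat S" and S0: "psd_mat S0"
    and X: "second_moment M X S" and Y: "second_moment M Y S0"
  shows "ennreal (gelbrich_sq S S0) \<le> (\<integral>\<^sup>+\<omega>. ennreal ((norm (X \<omega> - Y \<omega>))\<^sup>2) \<partial>M)"
proof -
  note [measurable] = second_moment_measurable [OF X] second_moment_measurable [OF Y]
  obtain C where C: "\<And>u v. u \<bullet> (C *v v) = (\<integral>\<omega>. (u \<bullet> X \<omega>) * (v \<bullet> Y \<omega>) \<partial>M)"
    and inner: "integrable M (\<lambda>\<omega>. X \<omega> \<bullet> Y \<omega>)" "trace C = (\<integral>\<omega>. X \<omega> \<bullet> Y \<omega> \<partial>M)"
    by (rule cross_moment_matrix_exists [OF X Y]) blast
  have "u \<bullet> (C *v v) \<le> sqrt (u \<bullet> (S *v u)) * sqrt (v \<bullet> (S0 *v v))" for u v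
    using integral_Cauchy_Schwarz [of "\<lambda>\<omega>. u \<bullet> X \<omega>" M "\<lambda>\<omega>. v \<bullet> Y \<omega>"] X Y
    by (simp add: C second_moment_def)
  then have "trace C \<le> fidelity S S0" by (rule trace_le_fidelity [OF S S0])
  moreover have "(norm (X \<omega> - Y \<omega>))\<^sup>2 = (norm (X \<omega>))\<^sup>2 + (norm (Y \<omega>))\<^sup>2 - 2 * (X \<omega> \<bullet> Y \<omega>)" for \<omega>
    by (simp add: power2_norm_eq_inner algebra_simps inner_commute)
  ultimately have "integrable M (\<lambda>\<omega>. (norm (X \<omega> - Y \<omega>))\<^sup>2)"
    "gelbrich_sq S S0 \<le> (\<integral>\<omega>. (norm (X \<omega> - Y \<omega>))\<^sup>2 \<partial>M)"
    using inner second_moment_norm_square [OF X] second_moment_norm_square [OF Y]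
    by (simp_all add: gelbrich_sq_eq_fidelity)
  then show ?thesis by (simp add: nn_integral_eq_integral ennreal_leI)
qed

section \<open>Optimal transport between normal laws\<close>

lemma std_gauss_eq_std_normal: "std_gauss = (std_normal :: (real^'d) measure)"
proof -
  have "(\<Prod>i\<in>UNIV. std_normal_density (z $ i))
    = (\<Prod>b\<in>Basis. std_normal_density (z \<bullet> b))" for z :: "real^'d"
  proof -
    have "(Basis :: (real^'d) set) = (\<lambda>i. axis i 1) ` UNIV"
      by (auto simp: Basis_vec_def)
    then have "(\<Prod>b\<in>Basis. std_normal_density (z \<bullet> b))
      = (\<Prod>b\<in>(\<lambda>i. axis i 1) ` UNIV. std_normal_density (z \<bullet> b))"
      by (rule arg_cong)
    also have "\<dots> = (\<Prod>i\<in>UNIV. std_normal_density (z $ i))"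
      by (subst prod.reindex) (auto simp: inj_on_def axis_eq_axis inner_axis)
    finally show ?thesis ..
  qed
  then show ?thesis by (simp only: std_gauss_def std_normal_def)
qed

lemma measurable_matrix_vector_mult [measurable]:
  "(\<lambda>z. A *v z) \<in> borel_measurable borel" for A :: "real^'n^'m"
  by (intro borel_measurable_linear matrix_vector_mul_linear)

lemma sets_gauss [simp, measurable_cong]: "sets (gauss mu S) = sets borel"
  by (simp add: gauss_def)

lemma prob_space_gauss: "prob_space (gauss mu S)"
  unfolding gauss_def std_gauss_eq_std_normal
  by (intro prob_space.prob_space_distr prob_space_std_normal) measurable

lemma gauss_eq_distr_orthogonal:
  assumes K: "orthogonal_matrix K"
  shows "gauss mu S = distr std_normal borel (\<lambda>z. mu + (msqrt S ** K) *v z)"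
proof -
  have "orthogonal_transformation (\<lambda>z. K *v z)"
    using K by (simp add: orthogonal_transformation_matrix)
  then have "gauss mu S = distr (distr std_normal borel (\<lambda>z. K *v z)) borel (\<lambda>z. mu + msqrt S *v z)"
    unfolding gauss_def std_gauss_eq_std_normal
    by (simp add: distr_std_normal_orthogonal_transformation)
  also have "\<dots> = distr std_normal borel ((\<lambda>z. mu + msqrt S *v z) \<circ> (\<lambda>z. K *v z))"
    by (intro distr_distr) measurable
  finally show ?thesis by (simp add: o_def matrix_vector_mul_assoc)
qed

lemma second_moment_gauss:
  assumes S: "psd_mat S"
  shows "second_moment (gauss mu S) (\<lambda>x. x - mu) S"
proof -
  have "(\<lambda>z. mu + msqrt S *v z) \<in> measurable std_normal borel" by measurable
  moreover have "second_moment std_normal (\<lambda>z. mu + msqrt S *v z - mu) S"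
  proof -
    have "u \<bullet> (msqrt S *v z) = z \<bullet> (msqrt S *v u)" for u z
      by (simp add: inner_matrix_vector_mult [of u] transpose_msqrt S inner_commute)
    then have square: "(u \<bullet> (msqrt S *v z))\<^sup>2 = (z \<bullet> (msqrt S *v u)) * (z \<bullet> (msqrt S *v u))" for u z
      by (simp add: power2_eq_square)
    have "linear_growth (\<lambda>z. z \<bullet> (msqrt S *v u))" for u
      by (intro linear_growth_linear) (simp add: linear_iff inner_add_left)
    from integrable_std_normal_inner_linear_growth [OF this this]
    have "integrable std_normal (\<lambda>z. (u \<bullet> (msqrt S *v z))\<^sup>2)" for u
      by (simp add: square)
    moreover have "(\<integral>z. (u \<bullet> (msqrt S *v z))\<^sup>2 \<partial>std_normal) = u \<bullet> (S *v u)" for u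
      using norm_msqrt_mult_vec [OF S, of u] inner_ge_zero [of "msqrt S *v u"]
      by (simp add: square integral_std_normal_inner norm_eq_sqrt_inner)
    ultimately show ?thesis by (simp add: second_moment_def)
  qed
  ultimately show ?thesis
    unfolding gauss_def std_gauss_eq_std_normal by (subst second_moment_distr_iff) simp_all
qed

lemma integral_std_normal_norm_linear_square:
  fixes f :: "'a::euclidean_space \<Rightarrow> 'b::euclidean_space"
  assumes f: "linear f"
  shows "(\<integral>z. (norm (f z))\<^sup>2 \<partial>std_normal) = (\<Sum>b\<in>Basis. (norm (adjoint f b))\<^sup>2)"
proof -
  have "(norm (f z))\<^sup>2 = (\<Sum>b\<in>Basis. (z \<bullet> adjoint f b) * (z \<bullet> adjoint f b))" for z
    unfolding power2_norm_eq_inner by (subst euclidean_inner) (simp add: adjoint_works [OF f])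
  moreover have "linear_growth (\<lambda>z :: 'a. z \<bullet> u)" for u
    by (intro linear_growth_linear) (simp add: linear_iff inner_add_left)
  from integrable_std_normal_inner_linear_growth [OF this this]
  have "integrable std_normal (\<lambda>z :: 'a. (z \<bullet> u) * (z \<bullet> u))" for u by simp
  ultimately show ?thesis by (simp add: integral_std_normal_inner power2_norm_eq_inner)
qed

lemma norm_matrix_eq_sum_Basis: "(norm A)\<^sup>2 = (\<Sum>b\<in>Basis. (norm (transpose A *v b))\<^sup>2)"
  for A :: "real^'n^'m"
proof -
  have "orthonormal_basis (Basis :: (real^'m) set)"
    by (auto simp: orthonormal_basis_def pairwise_def orthogonal_def inner_not_same_Basis)
  then show ?thesis
    by (simp add: norm_matrix_eq_trace trace_eq_sum_orthonormal_basis power2_norm_eq_inner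
        inner_matrix_vector_mult [of _ A] flip: matrix_vector_mul_assoc)
qed

lemma adjoint_matrix_vector_mult: "adjoint (\<lambda>z. A *v z) = (\<lambda>y. transpose A *v y)"
  for A :: "real^'n^'m"
  by (rule adjoint_unique) (simp add: inner_matrix_vector_mult)

lemma nn_integral_std_normal_norm_matrix_mult:
  "(\<integral>\<^sup>+z. ennreal ((norm (A *v z))\<^sup>2) \<partial>std_normal) = ennreal ((norm A)\<^sup>2)" for A :: "real^'n^'m"
  by (subst nn_integral_eq_integral)
    (simp_all add: integrable_std_normal_norm_square_linear_growth linear_growth_linear
      integral_std_normal_norm_linear_square adjoint_matrix_vector_mult norm_matrix_eq_sum_Basis)

lemma coupling_cost_ge_gelbrich_sq:
  fixes S S0 :: "real^'d^'d"
  assumes S: "psd_mat S" and S0: "psd_mat S0" and \<pi>: "\<pi> \<in> couplings (gauss mu S) (gauss mu S0)"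
  shows "ennreal (gelbrich_sq S S0) \<le> (\<integral>\<^sup>+p. ennreal ((norm (fst p - snd p))\<^sup>2) \<partial>\<pi>)"
proof -
  have sets: "sets \<pi> = sets borel" using \<pi> by (simp add: couplings_def)
  have [measurable]: "fst \<in> measurable \<pi> borel" "snd \<in> measurable \<pi> borel"
    by (auto simp: measurable_cong_sets [OF sets refl] simp flip: borel_prod)
  have "second_moment \<pi> (\<lambda>p. fst p - mu) S"
    using \<pi> second_moment_gauss [OF S, of mu]
      second_moment_distr_iff [of fst \<pi> borel "\<lambda>x. x - mu" S]
    by (simp add: couplings_def)
  moreover have "second_moment \<pi> (\<lambda>p. snd p - mu) S0"
    using \<pi> second_moment_gauss [OF S0, of mu]
      second_moment_distr_iff [of snd \<pi> borel "\<lambda>x. x - mu" S0]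
    by (simp add: couplings_def)
  ultimately show ?thesis using gelbrich_bound [OF S S0] by fastforce
qed

lemma coupling_cost_eq_gelbrich_sq:
  fixes S S0 :: "real^'d^'d"
  assumes S: "psd_mat S" and S0: "psd_mat S0"
  obtains \<pi> where "\<pi> \<in> couplings (gauss mu S) (gauss mu S0)"
    "(\<integral>\<^sup>+p. ennreal ((norm (fst p - snd p))\<^sup>2) \<partial>\<pi>) = ennreal (gelbrich_sq S S0)"
proof -
  obtain K where K: "orthogonal_matrix K" "gelbrich_sq S S0 = (norm (msqrt S ** K - msqrt S0))\<^sup>2"
    by (rule gelbrich_sq_attained [OF S S0])
  let ?X = "msqrt S ** K" and ?R = "msqrt S0"
  define f where "f z = (mu + ?X *v z, mu + ?R *v z)" for z
  have f: "f \<in> measurable std_normal borel"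
    unfolding f_def by (subst borel_prod [symmetric]) measurable
  have proj: "fst \<in> measurable (borel :: ((real^'d) \<times> (real^'d)) measure) borel"
    "snd \<in> measurable (borel :: ((real^'d) \<times> (real^'d)) measure) borel"
    by (simp_all flip: borel_prod)
  define \<pi> where "\<pi> = distr std_normal borel f"
  have "prob_space \<pi>"
    unfolding \<pi>_def by (intro prob_space.prob_space_distr prob_space_std_normal f)
  moreover have "distr \<pi> borel fst = gauss mu S"
    unfolding \<pi>_def gauss_eq_distr_orthogonal [OF K(1)]
    by (subst distr_distr [OF proj(1) f]) (simp add: o_def f_def)
  moreover have "distr \<pi> borel snd = gauss mu S0"
    unfolding \<pi>_def gauss_def std_gauss_eq_std_normal
    by (subst distr_distr [OF proj(2) f]) (simp add: o_def f_def)
  ultimately have "\<pi> \<in> couplings (gauss mu S) (gauss mu S0)"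
    by (simp add: couplings_def \<pi>_def)
  moreover have "(\<integral>\<^sup>+p. ennreal ((norm (fst p - snd p))\<^sup>2) \<partial>\<pi>) = ennreal (gelbrich_sq S S0)"
  proof -
    have [measurable]:
      "(\<lambda>p :: (real^'d) \<times> (real^'d). (norm (fst p - snd p))\<^sup>2) \<in> borel_measurable borel"
      by (intro borel_measurable_continuous_onI continuous_intros)
    have "(\<integral>\<^sup>+p. ennreal ((norm (fst p - snd p))\<^sup>2) \<partial>\<pi>)
        = (\<integral>\<^sup>+z. ennreal ((norm (fst (f z) - snd (f z)))\<^sup>2) \<partial>std_normal)"
      unfolding \<pi>_def using f by (intro nn_integral_distr) simp_all
    also have "\<dots> = (\<integral>\<^sup>+z. ennreal ((norm ((?X - ?R) *v z))\<^sup>2) \<partial>std_normal)"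
      by (simp add: f_def matrix_vector_mult.diff_left)
    finally show ?thesis by (simp only: nn_integral_std_normal_norm_matrix_mult K(2))
  qed
  ultimately show thesis by (rule that)
qed

theorem wasserstein2_gauss:
  assumes S: "psd_mat S" and S0: "psd_mat S0"
  shows "wasserstein2 (gauss mu S) (gauss mu S0) = sqrt (gelbrich_sq S S0)"
proof -
  let ?cost = "\<lambda>\<pi>. \<integral>\<^sup>+p. ennreal ((norm (fst p - snd p))\<^sup>2) \<partial>\<pi>"
  obtain \<pi> where \<pi>: "\<pi> \<in> couplings (gauss mu S) (gauss mu S0)"
    "?cost \<pi> = ennreal (gelbrich_sq S S0)"
    by (rule coupling_cost_eq_gelbrich_sq [OF S S0])
  have "(INF \<pi>\<in>couplings (gauss mu S) (gauss mu S0). ?cost \<pi>) = ennreal (gelbrich_sq S S0)"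
  proof (rule antisym)
    show "(INF \<pi>\<in>couplings (gauss mu S) (gauss mu S0). ?cost \<pi>) \<le> ennreal (gelbrich_sq S S0)"
      unfolding \<pi>(2) [symmetric] by (rule INF_lower [OF \<pi>(1)])
  qed (intro INF_greatest coupling_cost_ge_gelbrich_sq S S0)
  then show ?thesis using gelbrich_sq_nonneg [OF S S0] by (simp add: wasserstein2_def)
qed

lemma wasserstein2_gauss_le_iff:
  assumes "psd_mat S" "psd_mat S0" "0 \<le> r"
  shows "wasserstein2 (gauss mu S) (gauss mu S0) \<le> r \<longleftrightarrow> gelbrich_sq S S0 \<le> r\<^sup>2"
  using real_sqrt_le_iff [of "gelbrich_sq S S0" "r\<^sup>2"] assms by (simp add: wasserstein2_gauss)

lemma normal_ambiguity_set_eq_image: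
  assumes "psd_mat Sx0" "psd_mat Sw0" "0 \<le> rx" "0 \<le> rw"
  shows "normal_ambiguity_set mux Sx0 muw Sw0 rx rw
    = (\<lambda>S. gauss mux (fst S) \<Otimes>\<^sub>M gauss muw (snd S)) ` feasible Sx0 Sw0 rx rw"
proof -
  have "psd_mat Sx \<and> pd_mat Sw \<and> wasserstein2 (gauss mux Sx) (gauss mux Sx0) \<le> rx \<and>
      wasserstein2 (gauss muw Sw) (gauss muw Sw0) \<le> rw
      \<longleftrightarrow> (Sx, Sw) \<in> feasible Sx0 Sw0 rx rw" for Sx Sw
    using assms by (auto simp: feasible_def wasserstein2_gauss_le_iff pd_imp_psd_mat)
  then show ?thesis
    unfolding normal_ambiguity_set_def by (force simp: image_iff)
qed

section \<open>The mean squared error of linear estimators\<close>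

definition linear_mse :: "real^'n^'m \<Rightarrow> real^'m^'n \<Rightarrow> real^'n^'n \<Rightarrow> real^'m^'m \<Rightarrow> real" where
  "linear_mse H A Sx Sw =
    trace ((mat 1 - A ** H) ** Sx ** transpose (mat 1 - A ** H) + A ** Sw ** transpose A)"

definition gain :: "real^'n^'m \<Rightarrow> real^'n^'n \<Rightarrow> real^'m^'m \<Rightarrow> real^'m^'n" where
  "gain H Sx Sw = Sx ** transpose H ** matrix_inv (H ** Sx ** transpose H + Sw)"

lemma pd_mat_observation_covariance:
  "psd_mat Sx \<Longrightarrow> pd_mat Sw \<Longrightarrow> pd_mat (H ** Sx ** transpose H + Sw)"
  by (intro pd_mat_add psd_mat_congruence)

lemma gain_mult_observation_covariance:
  assumes "psd_mat Sx" "pd_mat Sw"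
  shows "gain H Sx Sw ** (H ** Sx ** transpose H + Sw) = Sx ** transpose H"
  using pd_mat_inv(2) [OF pd_mat_observation_covariance [OF assms]]
  by (simp add: gain_def flip: matrix_mul_assoc)

lemma linear_mse_eq_mmse_obj_plus:
  fixes H :: "real^'n^'m"
  assumes Sx: "psd_mat Sx" and Sw: "pd_mat Sw"
  shows "linear_mse H A Sx Sw = mmse_obj H Sx Sw
    + trace ((A - gain H Sx Sw) ** (H ** Sx ** transpose H + Sw) ** transpose (A - gain H Sx Sw))"
proof -
  define G where "G = H ** Sx ** transpose H + Sw"
  define B where "B = gain H Sx Sw"
  have pd: "pd_mat G" unfolding G_def using Sx Sw by (rule pd_mat_observation_covariance)
  have BG: "B ** G = Sx ** transpose H"
    unfolding B_def G_def by (rule gain_mult_observation_covariance [OF Sx Sw])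
  have GB: "G ** transpose B = H ** Sx"
    using arg_cong [OF BG, of transpose] pd
    by (simp add: matrix_transpose_mul psd_mat_symmetric [OF Sx] pd_mat_def)
  have "(A - B) ** G ** transpose (A - B)
      = A ** G ** transpose A - A ** (G ** transpose B)
        - (B ** G) ** transpose A + B ** (G ** transpose B)"
    by (simp add: transpose_diff matrix_mult_distribs matrix_mul_assoc)
  also have "\<dots>
    = A ** G ** transpose A - A ** H ** Sx - Sx ** transpose H ** transpose A + B ** H ** Sx"
    by (simp add: GB BG matrix_mul_assoc)
  finally have square: "(A - B) ** G ** transpose (A - B)
      = A ** G ** transpose A - A ** H ** Sx - Sx ** transpose H ** transpose A + B ** H ** Sx" .
  have "(mat 1 - A ** H) ** Sx ** transpose (mat 1 - A ** H) + A ** Sw ** transpose A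
      = (Sx - B ** H ** Sx) + (A - B) ** G ** transpose (A - B)"
    unfolding square
    by (simp add: G_def transpose_diff matrix_mult_distribs matrix_mul_assoc matrix_transpose_mul)
  moreover have "mmse_obj H Sx Sw = trace (Sx - B ** H ** Sx)"
    by (simp add: mmse_obj_def B_def gain_def)
  ultimately show ?thesis
    by (simp add: linear_mse_def trace_add flip: G_def B_def)
qed

lemma mmse_obj_le_linear_mse:
  assumes "psd_mat Sx" "pd_mat Sw"
  shows "mmse_obj H Sx Sw \<le> linear_mse H A Sx Sw"
  unfolding linear_mse_eq_mmse_obj_plus [OF assms]
  using assms
  by (simp add: trace_psd_mat_nonneg psd_mat_congruence pd_imp_psd_mat
      pd_mat_observation_covariance)

lemma linear_mse_gain:
  assumes "psd_mat Sx" "pd_mat Sw"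
  shows "linear_mse H (gain H Sx Sw) Sx Sw = mmse_obj H Sx Sw"
  unfolding linear_mse_eq_mmse_obj_plus [OF assms] by (simp add: trace_def)

lemma linear_mse_mono:
  assumes "loewner_ge Sx' Sx" "loewner_ge Sw' Sw"
  shows "linear_mse H A Sx Sw \<le> linear_mse H A Sx' Sw'"
proof -
  have "0 \<le> linear_mse H A (Sx' - Sx) (Sw' - Sw)"
    using assms unfolding linear_mse_def loewner_ge_def
    by (intro trace_psd_mat_nonneg psd_mat_add psd_mat_congruence)
  also have "\<dots> = linear_mse H A Sx' Sw' - linear_mse H A Sx Sw"
    by (simp add: linear_mse_def matrix_mult.diff_left matrix_mult.diff_right trace_add trace_sub)
  finally show ?thesis by simp
qed

lemma mmse_obj_mono:
  assumes "psd_mat Sx" "pd_mat Sw" "psd_mat Sx'" "pd_mat Sw'"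
    and "loewner_ge Sx' Sx" "loewner_ge Sw' Sw"
  shows "mmse_obj H Sx Sw \<le> mmse_obj H Sx' Sw'"
proof -
  have "mmse_obj H Sx Sw \<le> linear_mse H (gain H Sx' Sw') Sx Sw"
    using assms by (intro mmse_obj_le_linear_mse)
  also have "\<dots> \<le> linear_mse H (gain H Sx' Sw') Sx' Sw'"
    using assms by (intro linear_mse_mono)
  also have "\<dots> = mmse_obj H Sx' Sw'" using assms by (intro linear_mse_gain)
  finally show ?thesis .
qed

section \<open>Optimality of linear estimators for normal laws\<close>

lemma std_normal_pair:
  "std_normal \<Otimes>\<^sub>M std_normal = (std_normal :: ('a::euclidean_space \<times> 'b::euclidean_space) measure)"
proof -
  have "std_normal \<Otimes>\<^sub>M std_normal = density (lborel \<Otimes>\<^sub>M lborel :: ('a \<times> 'b) measure)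
      (\<lambda>(x, y). ennreal (\<Prod>b\<in>Basis. std_normal_density (x \<bullet> b))
        * ennreal (\<Prod>b\<in>Basis. std_normal_density (y \<bullet> b)))"
    unfolding std_normal_def
    by (rule pair_measure_density)
      (auto simp: sigma_finite_lborel prob_space_imp_sigma_finite prob_space_std_normal
        simp flip: std_normal_def)
  also have "\<dots> = std_normal"
    unfolding std_normal_def lborel_prod
    by (intro arg_cong [where f = "density lborel"] ext)
      (auto simp: prod_std_normal_density norm_Pair power_add add_divide_distrib
        simp flip: ennreal_mult exp_add)
  finally show ?thesis .
qed

lemma pair_gauss_eq_distr:
  "gauss mux Sx \<Otimes>\<^sub>M gauss muw Sw
    = distr std_normal (borel \<Otimes>\<^sub>M borel) (\<lambda>(z, z'). (mux + msqrt Sx *v z, muw + msqrt Sw *v z'))"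
  unfolding gauss_def std_gauss_eq_std_normal std_normal_pair [symmetric]
proof (rule pair_measure_distr)
  show "sigma_finite_measure (distr std_normal borel (\<lambda>z. muw + msqrt Sw *v z))"
    using prob_space_gauss [of muw Sw] unfolding gauss_def std_gauss_eq_std_normal
    by (rule prob_space_imp_sigma_finite)
qed measurable

lemma adjoint_matrix_pair:
  fixes U :: "real^'n^'k" and W :: "real^'m^'k"
  shows "adjoint (\<lambda>z. U *v fst z + W *v snd z) = (\<lambda>y. (transpose U *v y, transpose W *v y))"
  by (rule adjoint_unique)
    (simp add: inner_prod_def inner_add_left
      inner_matrix_vector_mult [where A = "transpose B" for B])

definition observation ::
  "real^'n^'m \<Rightarrow> real^'n^'n \<Rightarrow> real^'m^'m \<Rightarrow> (real^'n) \<times> (real^'m) \<Rightarrow> real^'m" where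
  "observation H Sx Sw z = (H ** msqrt Sx) *v fst z + msqrt Sw *v snd z"

definition linear_error ::
  "real^'n^'m \<Rightarrow> real^'m^'n \<Rightarrow> real^'n^'n \<Rightarrow> real^'m^'m \<Rightarrow> (real^'n) \<times> (real^'m) \<Rightarrow> real^'n" where
  "linear_error H A Sx Sw z = msqrt Sx *v fst z - A *v observation H Sx Sw z"

lemma linear_observation: "linear (observation H Sx Sw)"
  by (auto simp: linear_iff observation_def algebra_simps)

lemma linear_linear_error: "linear (linear_error H A Sx Sw)"
  by (auto simp: linear_iff linear_error_def observation_def algebra_simps)

lemma integral_linear_error_square:
  fixes H :: "real^'n^'m" and A :: "real^'m^'n"
  assumes Sx: "psd_mat Sx" and Sw: "psd_mat Sw"
  shows "(\<integral>z. (norm (linear_error H A Sx Sw z))\<^sup>2 \<partial>std_normal) = linear_mse H A Sx Sw"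
proof -
  let ?U = "(mat 1 - A ** H) ** msqrt Sx" and ?W = "- (A ** msqrt Sw)"
  have "linear_error H A Sx Sw = (\<lambda>z. ?U *v fst z + ?W *v snd z)"
    by (simp add: fun_eq_iff linear_error_def observation_def algebra_simps
        matrix_vector_mult.minus_left matrix_mult.diff_left matrix_vector_mul_assoc matrix_mul_assoc)
  then have "(\<integral>z. (norm (linear_error H A Sx Sw z))\<^sup>2 \<partial>std_normal) = (norm ?U)\<^sup>2 + (norm ?W)\<^sup>2"
    using integral_std_normal_norm_linear_square [OF linear_linear_error [of H A Sx Sw]]
    by (simp add: adjoint_matrix_pair norm_Pair sum.distrib flip: norm_matrix_eq_sum_Basis)
  then show ?thesis
    unfolding norm_minus_cancel norm_matrix_eq_trace linear_mse_def
    by (simp add: mult_msqrt_mult_transpose Sx Sw trace_add)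
qed

lemma linear_error_gain_uncorrelated:
  assumes Sx: "psd_mat Sx" and Sw: "pd_mat Sw"
  shows "linear_error H (gain H Sx Sw) Sx Sw (adjoint (observation H Sx Sw) u) = 0"
proof -
  let ?z = "adjoint (observation H Sx Sw) u"
  note Sw' = pd_imp_psd_mat [OF Sw]
  have z: "?z = (transpose (H ** msqrt Sx) *v u, transpose (msqrt Sw) *v u)"
    by (simp add: observation_def [abs_def] adjoint_matrix_pair)
  have "msqrt Sx *v fst ?z = (Sx ** transpose H) *v u"
    by (simp add: z matrix_transpose_mul transpose_msqrt Sx matrix_vector_mul_assoc
        matrix_mul_assoc msqrt_mult_self)
  moreover have "observation H Sx Sw ?z = (H ** Sx ** transpose H + Sw) *v u"
    using mult_msqrt_mult_transpose [OF Sx, of H] mult_msqrt_mult_transpose [OF Sw', of "mat 1"]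
    by (simp add: z observation_def matrix_vector_mul_assoc matrix_vector_mult.add_left)
  ultimately show ?thesis
    by (simp add: linear_error_def matrix_vector_mul_assoc
        gain_mult_observation_covariance [OF Sx Sw])
qed

lemma mse_gauss:
  fixes H :: "real^'n^'m" and mux :: "real^'n" and muw :: "real^'m"
  assumes \<psi>: "linear_growth \<psi>" and Sx: "psd_mat Sx" and Sw: "pd_mat Sw"
  defines "\<phi> \<equiv> \<lambda>u. mux + gain H Sx Sw *v u - \<psi> (H *v mux + muw + u)"
  shows "mse H \<psi> (gauss mux Sx \<Otimes>\<^sub>M gauss muw Sw)
    = mmse_obj H Sx Sw + (\<integral>z. (norm (\<phi> (observation H Sx Sw z)))\<^sup>2 \<partial>std_normal)"
proof -
  let ?x = "\<lambda>z. mux + msqrt Sx *v fst z" and ?w = "\<lambda>z. muw + msqrt Sw *v snd z"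
  let ?Y = "observation H Sx Sw" and ?e = "linear_error H (gain H Sx Sw) Sx Sw"
  have \<phi>: "linear_growth \<phi>"
    unfolding \<phi>_def
    by (intro linear_growth_diff linear_growth_add linear_growth_const linear_growth_compose [OF \<psi>]
        linear_growth_linear matrix_vector_mul_linear linear_ident)
  have "mse H \<psi> (gauss mux Sx \<Otimes>\<^sub>M gauss muw Sw)
      = (\<integral>z. (norm (?x z - \<psi> (H *v ?x z + ?w z)))\<^sup>2 \<partial>std_normal)"
    using linear_growth_measurable [OF \<psi>]
    unfolding mse_def pair_gauss_eq_distr std_normal_pair [symmetric]
    by (subst integral_distr) (simp_all add: case_prod_beta)
  also have "\<dots> = (\<integral>z. (norm (?e z + \<phi> (?Y z)))\<^sup>2 \<partial>std_normal)"
    by (simp add: \<phi>_def linear_error_def observation_def algebra_simps matrix_vector_mul_assoc)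
  also have "\<dots> = (\<integral>z. (norm (?e z))\<^sup>2 \<partial>std_normal) + (\<integral>z. (norm (\<phi> (?Y z)))\<^sup>2 \<partial>std_normal)"
    by (rule integral_std_normal_norm_add_square [OF linear_observation linear_linear_error
          linear_error_gain_uncorrelated [OF Sx Sw] \<phi>])
  also have "(\<integral>z. (norm (?e z))\<^sup>2 \<partial>std_normal) = mmse_obj H Sx Sw"
    by (simp add: integral_linear_error_square linear_mse_gain Sx Sw pd_imp_psd_mat)
  finally show ?thesis .
qed

theorem INF_mse_gauss:
  fixes H :: "real^'n^'m"
  assumes Sx: "psd_mat Sx" and Sw: "pd_mat Sw"
  shows "(INF \<psi>\<in>estimators. ereal (mse H \<psi> (gauss mux Sx \<Otimes>\<^sub>M gauss muw Sw)))
    = ereal (mmse_obj H Sx Sw)"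
proof (rule antisym)
  define \<psi> where "\<psi> y = (mux - gain H Sx Sw *v (H *v mux + muw)) + gain H Sx Sw *v y" for y
  have \<psi>: "linear_growth \<psi>"
    unfolding \<psi>_def
    by (intro linear_growth_add linear_growth_const linear_growth_linear matrix_vector_mul_linear)
  have "mse H \<psi> (gauss mux Sx \<Otimes>\<^sub>M gauss muw Sw) = mmse_obj H Sx Sw"
    unfolding mse_gauss [OF \<psi> Sx Sw] by (simp add: \<psi>_def algebra_simps)
  then show "(INF \<psi>\<in>estimators. ereal (mse H \<psi> (gauss mux Sx \<Otimes>\<^sub>M gauss muw Sw)))
    \<le> ereal (mmse_obj H Sx Sw)"
    using \<psi> by (intro INF_lower2 [of \<psi>]) (simp_all add: estimators_eq)
  show "ereal (mmse_obj H Sx Sw)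
    \<le> (INF \<psi>\<in>estimators. ereal (mse H \<psi> (gauss mux Sx \<Otimes>\<^sub>M gauss muw Sw)))"
    by (rule INF_greatest) (simp add: mse_gauss Sx Sw estimators_eq)
qed

section \<open>Existence of a maximizer\<close>

lemma upper_semicontinuous_attains_sup:
  fixes f :: "'a::topological_space \<Rightarrow> 'b::linorder"
  assumes C: "compact C" "C \<noteq> {}" and usc: "\<And>c. openin (top_of_set C) {x \<in> C. f x < c}"
  obtains x where "x \<in> C" "\<And>y. y \<in> C \<Longrightarrow> f y \<le> f x"
proof -
  have "\<exists>x\<in>C. \<forall>y\<in>C. f y \<le> f x"
  proof (rule ccontr)
    assume "\<not> ?thesis"
    then have cover: "C \<subseteq> \<Union> ((\<lambda>y. {x \<in> C. f x < f y}) ` C)" by (fastforce simp: not_le)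
    have "\<forall>U\<in>(\<lambda>y. {x \<in> C. f x < f y}) ` C. openin (top_of_set C) U" using usc by auto
    from C(1) [unfolded compact_eq_openin_cover, THEN spec, THEN mp, OF conjI [OF this cover]]
    obtain \<U> where \<U>: "\<U> \<subseteq> (\<lambda>y. {x \<in> C. f x < f y}) ` C" "finite \<U>" "C \<subseteq> \<Union> \<U>" by blast
    from finite_subset_image [OF \<U>(2,1)] \<U>(3)
    obtain Y where Y: "Y \<subseteq> C" "finite Y" "C \<subseteq> (\<Union>y\<in>Y. {x \<in> C. f x < f y})" by auto
    then have "Max (f ` Y) \<in> f ` Y" using C(2) by (intro Max_in) auto
    then obtain m where m: "m \<in> Y" "f m = Max (f ` Y)" by auto
    then obtain y where y: "y \<in> Y" "f m < f y" using Y by blast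
    then have "f y \<le> f m" using m Y(2) by simp
    with y show False by simp
  qed
  then show thesis using that by blast
qed

lemma openin_mmse_obj_less:
  fixes H :: "real^'n^'m"
  assumes D: "\<And>S. S \<in> D \<Longrightarrow> psd_mat (fst S) \<and> pd_mat (snd S)"
  shows "openin (top_of_set D) {S \<in> D. mmse_obj H (fst S) (snd S) < c}"
proof -
  have "mmse_obj H (fst S) (snd S) < c \<longleftrightarrow> (\<exists>A. linear_mse H A (fst S) (snd S) < c)" if "S \<in> D" for S
    using D [OF that] mmse_obj_le_linear_mse linear_mse_gain by (metis le_less_trans)
  then have "{S \<in> D. mmse_obj H (fst S) (snd S) < c}
      = (\<Union>A. D \<inter> (\<lambda>S. linear_mse H A (fst S) (snd S)) -` {..<c})" by auto
  moreover have "openin (top_of_set D) (D \<inter> (\<lambda>S. linear_mse H A (fst S) (snd S)) -` {..<c})" for A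
    unfolding linear_mse_def by (intro continuous_openin_preimage_gen continuous_intros)
  ultimately show ?thesis by (metis (no_types, lifting) openin_Union imageE)
qed

definition definite_feasible ::
  "real^'n^'n \<Rightarrow> real^'m^'m \<Rightarrow> real \<Rightarrow> real \<Rightarrow> ((real^'n^'n) \<times> (real^'m^'m)) set" where
  "definite_feasible Sx0 Sw0 rx rw = {S \<in> feasible Sx0 Sw0 rx rw.
      loewner_ge (fst S) (lambda_min Sx0 *\<^sub>R mat 1) \<and> loewner_ge (snd S) (lambda_min Sw0 *\<^sub>R mat 1)}"

lemma compact_definite_feasible:
  assumes "psd_mat Sx0" and Sw0: "pd_mat Sw0" and "0 \<le> rx" "0 \<le> rw"
  shows "compact (definite_feasible Sx0 Sw0 rx rw)"
proof -
  have "definite_feasible Sx0 Sw0 rx rw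
      = ({S. psd_mat S \<and> gelbrich_sq S Sx0 \<le> rx\<^sup>2} \<inter> {S. loewner_ge S (lambda_min Sx0 *\<^sub>R mat 1)})
      \<times> ({S. psd_mat S \<and> gelbrich_sq S Sw0 \<le> rw\<^sup>2} \<inter> {S. loewner_ge S (lambda_min Sw0 *\<^sub>R mat 1)})"
    using loewner_ge_imp_pd_mat [OF _ lambda_min_pos [OF Sw0]]
    by (auto simp: definite_feasible_def feasible_def pd_imp_psd_mat)
  then show ?thesis
    using assms by (simp add: compact_Times compact_Int_closed compact_gelbrich_ball
        closed_loewner_ge pd_imp_psd_mat)
qed

lemma feasible_dominated:
  assumes Sx0: "psd_mat Sx0" and Sw0: "pd_mat Sw0" and S: "S \<in> feasible Sx0 Sw0 rx rw"
  obtains S' where "S' \<in> definite_feasible Sx0 Sw0 rx rw"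
    "mmse_obj H (fst S) (snd S) \<le> mmse_obj H (fst S') (snd S')"
proof -
  obtain Sx Sw where Sx_Sw: "S = (Sx, Sw)" by (cases S)
  with S have Sx: "psd_mat Sx" "gelbrich_sq Sx Sx0 \<le> rx\<^sup>2"
    and Sw: "pd_mat Sw" "gelbrich_sq Sw Sw0 \<le> rw\<^sup>2"
    by (auto simp: feasible_def)
  obtain Sx' where Sx': "psd_mat Sx'" "loewner_ge Sx' Sx" "loewner_ge Sx' (lambda_min Sx0 *\<^sub>R mat 1)"
    "gelbrich_sq Sx' Sx0 \<le> gelbrich_sq Sx Sx0"
    using gelbrich_ball_dominated [OF Sx(1) loewner_ge_lambda_min lambda_min_nonneg] Sx0
    by (metis psd_mat_symmetric)
  obtain Sw' where Sw': "psd_mat Sw'" "loewner_ge Sw' Sw" "loewner_ge Sw' (lambda_min Sw0 *\<^sub>R mat 1)"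
    "gelbrich_sq Sw' Sw0 \<le> gelbrich_sq Sw Sw0"
    using gelbrich_ball_dominated
        [OF pd_imp_psd_mat [OF Sw(1)] loewner_ge_lambda_min lambda_min_nonneg] Sw0
    by (metis psd_mat_symmetric pd_imp_psd_mat)
  have pd: "pd_mat Sw'" using Sw'(3) lambda_min_pos [OF Sw0] by (rule loewner_ge_imp_pd_mat)
  show thesis
  proof
    show "(Sx', Sw') \<in> definite_feasible Sx0 Sw0 rx rw"
      using Sx Sx' Sw Sw' pd by (simp add: definite_feasible_def feasible_def)
    show "mmse_obj H (fst S) (snd S) \<le> mmse_obj H (fst (Sx', Sw')) (snd (Sx', Sw'))"
      using Sx Sx' Sw Sw' pd by (simp add: Sx_Sw mmse_obj_mono)
  qed
qed

lemma mmse_obj_maximizer: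
  fixes H :: "real^'n^'m"
  assumes Sx0: "psd_mat Sx0" and Sw0: "pd_mat Sw0" and r: "0 \<le> rx" "0 \<le> rw"
  obtains S where "S \<in> definite_feasible Sx0 Sw0 rx rw"
    "\<And>S'. S' \<in> feasible Sx0 Sw0 rx rw \<Longrightarrow> mmse_obj H (fst S') (snd S') \<le> mmse_obj H (fst S) (snd S)"
proof -
  let ?D = "definite_feasible Sx0 Sw0 rx rw" and ?f = "\<lambda>S. mmse_obj H (fst S) (snd S)"
  have "(Sx0, Sw0) \<in> feasible Sx0 Sw0 rx rw"
    using Sx0 Sw0 by (simp add: feasible_def gelbrich_sq_self pd_imp_psd_mat)
  then have nonempty: "?D \<noteq> {}" using feasible_dominated [OF Sx0 Sw0] by blast
  have usc: "openin (top_of_set ?D) {S \<in> ?D. ?f S < c}" for c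
    by (rule openin_mmse_obj_less) (auto simp: definite_feasible_def feasible_def)
  obtain S where S: "S \<in> ?D" and max: "\<And>S'. S' \<in> ?D \<Longrightarrow> ?f S' \<le> ?f S"
    by (rule upper_semicontinuous_attains_sup
        [OF compact_definite_feasible [OF assms] nonempty usc]) blast
  have "?f S' \<le> ?f S" if feasible: "S' \<in> feasible Sx0 Sw0 rx rw" for S'
  proof -
    obtain T where "T \<in> ?D" "?f S' \<le> ?f T"
      by (rule feasible_dominated [OF Sx0 Sw0 feasible, of H])
    then show ?thesis using max [of T] by simp
  qed
  with S show thesis by (rule that)
qed

theorem mainTheorem7:
  fixes H :: "real^'n^'m"
    and mux :: "real^'n" and Sx0 :: "real^'n^'n"
    and muw :: "real^'m" and Sw0 :: "real^'m^'m"
    and rx rw :: real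
  assumes "psd_mat Sx0" and "psd_mat Sw0" and "0 \<le> rx" and "0 \<le> rw"
  shows "(SUP Q\<in>normal_ambiguity_set mux Sx0 muw Sw0 rx rw.
            (INF \<psi>\<in>estimators. ereal (mse H \<psi> Q)))
         = (SUP S\<in>feasible Sx0 Sw0 rx rw. ereal (mmse_obj H (fst S) (snd S)))
       \<and> (pd_mat Sw0 \<longrightarrow>
           (\<exists>Sx Sw. (Sx, Sw) \<in> feasible Sx0 Sw0 rx rw \<and>
              ereal (mmse_obj H Sx Sw) = (SUP S\<in>feasible Sx0 Sw0 rx rw. ereal (mmse_obj H (fst S) (snd S))) \<and>
              loewner_ge Sx (lambda_min Sx0 *\<^sub>R mat 1) \<and>
              loewner_ge Sw (lambda_min Sw0 *\<^sub>R mat 1))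
         \<and> (\<forall>Sx Sw. (Sx, Sw) \<in> feasible Sx0 Sw0 rx rw \<and>
              ereal (mmse_obj H Sx Sw) = (SUP S\<in>feasible Sx0 Sw0 rx rw. ereal (mmse_obj H (fst S) (snd S)))
              \<longrightarrow> gauss mux Sx \<Otimes>\<^sub>M gauss muw Sw \<in> normal_ambiguity_set mux Sx0 muw Sw0 rx rw
                \<and> (INF \<psi>\<in>estimators. ereal (mse H \<psi> (gauss mux Sx \<Otimes>\<^sub>M gauss muw Sw)))
                  = (SUP Q\<in>normal_ambiguity_set mux Sx0 muw Sw0 rx rw.
                      (INF \<psi>\<in>estimators. ereal (mse H \<psi> Q)))))"
proof -
  let ?F = "feasible Sx0 Sw0 rx rw" and ?f = "\<lambda>S. ereal (mmse_obj H (fst S) (snd S))"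
  let ?law = "\<lambda>S. gauss mux (fst S) \<Otimes>\<^sub>M gauss muw (snd S)"
  have INF_eq: "(INF \<psi>\<in>estimators. ereal (mse H \<psi> (?law S))) = ?f S" if "S \<in> ?F" for S
    using that by (intro INF_mse_gauss) (auto simp: feasible_def)
  have ambiguity: "normal_ambiguity_set mux Sx0 muw Sw0 rx rw = ?law ` ?F"
    by (rule normal_ambiguity_set_eq_image [OF assms])
  have SUP_eq:
    "(SUP Q\<in>normal_ambiguity_set mux Sx0 muw Sw0 rx rw. INF \<psi>\<in>estimators. ereal (mse H \<psi> Q))
      = (SUP S\<in>?F. ?f S)"
    unfolding ambiguity image_image by (rule SUP_cong) (simp_all add: INF_eq)
  have "\<exists>Sx Sw. (Sx, Sw) \<in> ?F \<and> ereal (mmse_obj H Sx Sw) = (SUP S\<in>?F. ?f S) \<and>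
      loewner_ge Sx (lambda_min Sx0 *\<^sub>R mat 1) \<and> loewner_ge Sw (lambda_min Sw0 *\<^sub>R mat 1)"
    if Sw0: "pd_mat Sw0"
  proof -
    obtain S where S: "S \<in> definite_feasible Sx0 Sw0 rx rw" and "\<And>S'. S' \<in> ?F \<Longrightarrow> ?f S' \<le> ?f S"
      by (rule mmse_obj_maximizer [OF assms(1) Sw0 assms(3,4), of H]) auto
    moreover from S have "S \<in> ?F" by (simp add: definite_feasible_def)
    ultimately have "(SUP S\<in>?F. ?f S) = ?f S"
      by (intro antisym SUP_least SUP_upper)
    with S show ?thesis by (cases S) (auto simp: definite_feasible_def)
  qed
  moreover have "?law (Sx, Sw) \<in> normal_ambiguity_set mux Sx0 muw Sw0 rx rw"
    if "(Sx, Sw) \<in> ?F" for Sx Sw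
    unfolding ambiguity using that by (rule imageI)
  ultimately show ?thesis using SUP_eq INF_eq by auto
qed

end
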